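(* Let $A$ and $B$ be two matrices over a field, of dimension respectively $n\times n$ and $n\times m$. The Kalman form of $A$ and $B$ can be computed in $O(n^{\omega}\log n)$ field operations.
   Context: The number $\omega$ denotes the exponent in the complexity of matrix multiplication, and complexity is algebraic, i.e. one counts operations in the base field. Kalman form of $A$ and $B$: let $r$ be the dimension of $\mathrm{Span}(B,AB,\dots,A^{n-1}B)$ (the span of all columns of these matrices). There exists a non-singular $n\times n$ matrix $T$ such that $$T^{-1}AT=\begin{bmatrix} H & X\\ 0 & Y\end{bmatrix},\qquad T^{-1}B=\begin{bmatrix} B_1\\ 0\end{bmatrix},$$ where $H$ is $r\times r$ and $B_1$ is $r\times m$ (so $X$ is $r\times(n-r)$ and $Y$ is $(n-r)\times(n-r)$). Computing the Kalman form means computing such a $T$ together with the blocks $H,X,Y,B_1$.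
   Formalization: The formal theorem assumes m ≤ c·n for an arbitrary fixed constant c, with a bound uniform in such m; for unbounded m the bound in n alone is false, since for B = 0 all nm entries of B must be read. *)

theory Defs
  imports
    "Jordan_Normal_Form.DL_Rank"
    "HOL-Algebra.Subrings"
    "HOL-Library.Landau_Symbols"
begin

section \<open>Algebraic computation trees\<close>

text \<open>
  The model of algebraic complexity is the algebraic computation tree. The memory is a list of
  field elements, initially the input; every computed value and every constant is appended to it,
  and nodes refer to earlier values by their position. A tree has no access to field elements other
  than by arithmetic and by testing for zero. A leaf carries the list of positions of the output
  values, and a label for output that is not a field element (for instance a dimension).
\<close>

datatype arith_op = Plus | Minus | Times | Divide

datatype ('l, scalars: 'a) ctree =
    Leaf 'l "nat list"
  | Const 'a "('l, 'a) ctree"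
  | Arith arith_op nat nat "('l, 'a) ctree"
  | Test nat "('l, 'a) ctree" "('l, 'a) ctree"

text \<open>Division by zero is an error here, unlike in HOL, where \<open>x / 0 = 0\<close>.\<close>

fun arith :: "arith_op \<Rightarrow> 'a::field \<Rightarrow> 'a \<Rightarrow> 'a option" where
  "arith Plus x y = Some (x + y)"
| "arith Minus x y = Some (x - y)"
| "arith Times x y = Some (x * y)"
| "arith Divide x y = (if y = 0 then None else Some (x / y))"

text \<open>
  The result consists of the label, the output values and the number of field operations on the
  path taken. Arithmetic operations and zero tests cost 1, constants are free.
  The result is \<open>None\<close> if there is a division by zero or an access outside the memory.
\<close>

primrec run :: "('l, 'a::field) ctree \<Rightarrow> 'a list \<Rightarrow> ('l \<times> 'a list \<times> nat) option" where
  "run (Leaf l is) xs =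
     (if \<forall>i\<in>set is. i < length xs then Some (l, map ((!) xs) is, 0) else None)"
| "run (Const a t) xs = run t (xs @ [a])"
| "run (Arith f i j t) xs =
     (if i < length xs \<and> j < length xs then
        (case arith f (xs ! i) (xs ! j) of
           None \<Rightarrow> None
         | Some v \<Rightarrow> map_option (\<lambda>(l, ys, k). (l, ys, Suc k)) (run t (xs @ [v])))
      else None)"
| "run (Test i t u) xs =
     (if i < length xs then
        map_option (\<lambda>(l, ys, k). (l, ys, Suc k)) (if xs ! i = 0 then run t xs else run u xs)
      else None)"

text \<open>Matrices are passed to and returned by trees row by row.\<close>

abbreviation entries :: "'a mat \<Rightarrow> 'a list" where
  "entries A \<equiv> concat (mat_to_list A)"


section \<open>Exponents of matrix multiplication\<close>

text \<open>
  Here and below, \<open>K\<close> is a subfield from which the constants of the trees are taken, whereas the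
  matrices have entries in the whole field \<open>'a\<close>. The usual model is \<open>K = UNIV\<close>. Other choices matter
  for finite fields: over a finite field, a tree could identify every entry of the input by a
  bounded number of tests and look up the output in a table. For a finite \<open>K\<close> inside an infinite
  \<open>'a\<close> this is impossible, and a tree that is correct over \<open>'a\<close> is correct for matrices over \<open>K\<close>.
\<close>

definition matmul_within :: "'a::field set \<Rightarrow> nat \<Rightarrow> nat \<Rightarrow> bool" where
  "matmul_within K n t \<longleftrightarrow>
     (\<exists>P :: (unit, 'a) ctree. scalars P \<subseteq> K \<and>
        (\<forall>A \<in> carrier_mat n n. \<forall>B \<in> carrier_mat n n.
           \<exists>k \<le> t. run P (entries A @ entries B) = Some ((), entries (A * B), k)))"

text \<open>
  A bound \<open>O(n\<^sup>\<omega>)\<close> on the cost of an algorithm using matrix multiplication presupposes that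
  \<open>n \<times> n\<close> matrices can be multiplied in \<open>O(n\<^sup>\<omega>)\<close> operations. The infimum of all such \<open>\<omega>\<close> is not
  known to have this property itself, so \<open>\<omega>\<close> stands for any real number that has it.
\<close>

definition matmul_exponent :: "'a::field set \<Rightarrow> real \<Rightarrow> bool" where
  "matmul_exponent K \<omega> \<longleftrightarrow>
     (\<exists>f :: nat \<Rightarrow> nat. (\<lambda>n. real (f n)) \<in> O(\<lambda>n. real n powr \<omega>) \<and> (\<forall>n. matmul_within K n (f n)))"


section \<open>Kalman form\<close>

definition (in vec_space) krylov_dim :: "'a mat \<Rightarrow> 'a mat \<Rightarrow> nat" where
  "krylov_dim A B = vectorspace.dim class_ring (span_vs (\<Union>k<n. set (cols (A ^\<^sub>m k * B))))"

definition is_kalman_form ::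
  "nat \<Rightarrow> nat \<Rightarrow> 'a::field mat \<Rightarrow> 'a mat \<Rightarrow> nat \<Rightarrow> 'a mat \<Rightarrow> 'a mat \<Rightarrow> 'a mat \<Rightarrow> 'a mat \<Rightarrow> 'a mat \<Rightarrow> bool"
  where
  "is_kalman_form n m A B r T H X Y B\<^sub>1 \<longleftrightarrow>
     r = vec_space.krylov_dim n A B \<and>
     T \<in> carrier_mat n n \<and>
     H \<in> carrier_mat r r \<and> X \<in> carrier_mat r (n - r) \<and> Y \<in> carrier_mat (n - r) (n - r) \<and>
     B\<^sub>1 \<in> carrier_mat r m \<and>
     (\<exists>T'. T' \<in> carrier_mat n n \<and> inverts_mat T T' \<and> inverts_mat T' T \<and>
        T' * A * T = four_block_mat H X (0\<^sub>m (n - r) r) Y \<and>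
        T' * B = B\<^sub>1 @\<^sub>r 0\<^sub>m (n - r) m)"

definition kalman_within :: "'a::field set \<Rightarrow> nat \<Rightarrow> nat \<Rightarrow> nat \<Rightarrow> bool" where
  "kalman_within K n m t \<longleftrightarrow>
     (\<exists>P :: (nat, 'a) ctree. scalars P \<subseteq> K \<and>
        (\<forall>A \<in> carrier_mat n n. \<forall>B \<in> carrier_mat n m.
           \<exists>r T H X Y B\<^sub>1. is_kalman_form n m A B r T H X Y B\<^sub>1 \<and>
             (\<exists>k \<le> t. run P (entries A @ entries B) =
                Some (r, entries T @ entries H @ entries X @ entries Y @ entries B\<^sub>1, k))))"

end

theory Submission
  imports Defs
begin

text \<open>
  The Krylov spaces \<open>K\<^sub>k = Span(B, \<dots>, A\<^sup>k\<^sup>-\<^sup>1B)\<close> are computed by doubling, with \<open>A\<^sup>h\<close> obtained by repeated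
  squaring. If the columns of \<open>W\<close> complement \<open>K\<^sub>k\<^sub>-\<^sub>h\<close> in \<open>K\<^sub>k\<close>, then \<open>A\<^sup>hW\<close> and \<open>A\<^sup>2\<^sup>hW\<close> extend \<open>K\<^sub>k\<close> to
  \<open>K\<^sub>k\<^sub>+\<^sub>2\<^sub>h\<close>, and the columns that are really needed are the next \<open>W\<close>. Over all \<open>O(log n)\<close> steps only
  \<open>O(n)\<close> columns have to be eliminated. This matters when \<open>\<omega> = 2\<close>, as eliminating \<open>c \<le> n\<close> columns by
  halving the set of columns takes \<open>O(n\<^sup>\<omega>\<^sup>-\<^sup>1 c log n)\<close> operations, with a logarithm of its own.

  A space is represented by a matrix \<open>G\<close> whose rows \<open>I\<close> form the identity matrix. Then a matrix \<open>C\<close> is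
  reduced modulo the columns of \<open>G\<close> by subtracting \<open>G\<close> times the rows \<open>I\<close> of \<open>C\<close>, and \<open>T\<close> is obtained from \<open>G\<close> by
  appending the unit vectors of the other rows, which makes the blocks of the Kalman form explicit.

  Linear overhead per column is \<open>O(n\<^sup>\<omega>\<^sup>-\<^sup>1)\<close> because \<open>\<omega> \<ge> 2\<close>: a tree that multiplies \<open>n \<times> n\<close> matrices
  has to read at least \<open>n\<^sup>2\<close> of their entries.
\<close>


section \<open>A lower bound for matrix multiplication\<close>

text \<open>The expensive operations are products of rectangular matrices, charged per column:
  \<open>\<mu> * e\<close> pays for a product in which only the number of rows may exceed
  \<open>e\<close>, and \<open>\<mu>\<close> is of order n^(\<omega>-1). Selecting, permuting and
  concatenating rows or columns costs nothing, because every branch of a tree knows the positions it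
  works with; so pivots may lie in any rows and are never moved. The identity block does two jobs.
  It removes all inversions: coordinates with respect to \<open>G\<close>, and even the product with
  the inverse of \<open>T\<close>, are read off from rows and corrected by one product. It also lets
  \<open>length I\<close> stand for the dimension, so that dimensions in the sense of vector spaces
  appear only where the result is compared with \<open>krylov_dim\<close>.\<close>

lemma concat_map_upt_eq:
  "concat (map (\<lambda>i. map (f i) [0..<c]) [0..<r]) = map (\<lambda>p. f (p div c) (p mod c)) [0..<r * c]"
proof (induction r)
  case (Suc r)
  have "map (\<lambda>p. f (p div c) (p mod c)) [r * c..<r * c + c] = map (f r) [0..<c]"
    by (rule nth_equalityI) auto
  then show ?case
    using Suc upt_add_eq_append[of 0 "r * c" c] by (simp add: add.commute)
qed simp

lemma entries_conv: "entries A = map (\<lambda>p. A $$ (p div dim_col A, p mod dim_col A)) [0..<dim_row A * dim_col A]"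
  unfolding mat_to_list_def by (rule concat_map_upt_eq)

lemma length_entries [simp]: "length (entries A) = dim_row A * dim_col A"
  unfolding entries_conv by simp

lemma index_less: "i < r \<Longrightarrow> j < c \<Longrightarrow> i * c + j < r * (c::nat)"
  using mult_le_mono1[of "Suc i" r c] by simp

lemma nth_entries: "i < dim_row A \<Longrightarrow> j < dim_col A \<Longrightarrow> entries A ! (i * dim_col A + j) = A $$ (i, j)"
  unfolding entries_conv by (simp add: index_less)


text \<open>Output positions at a leaf are not counted as read, because \<open>run\<close> copies
  them at no cost; an unread input can therefore still appear in the output. Positions of computed
  values are counted, which preserves the bound of two reads per unit of cost.\<close>

primrec trace :: "('l, 'a::field) ctree \<Rightarrow> 'a list \<Rightarrow> nat set" where
  "trace (Leaf l is) xs = {}"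
| "trace (Const a t) xs = trace t (xs @ [a])"
| "trace (Arith f i j t) xs = {i, j} \<union> trace t (xs @ [the (arith f (xs ! i) (xs ! j))])"
| "trace (Test i t u) xs = {i} \<union> (if xs ! i = 0 then trace t xs else trace u xs)"

lemma card_trace:
  "run t xs = Some (l, out, k) \<Longrightarrow> finite (trace t xs) \<and> card (trace t xs) \<le> 2 * k"
proof (induction t arbitrary: xs l out k)
  case (Arith f i j t)
  then obtain v k' where v: "arith f (xs ! i) (xs ! j) = Some v"
    "run t (xs @ [v]) = Some (l, out, k')" "k = Suc k'"
    by (auto split: if_splits option.splits)
  have "finite (trace t (xs @ [v])) \<and> card (trace t (xs @ [v])) \<le> 2 * k'"
    using Arith.IH[OF v(2)] .
  moreover have "card ({i, j} \<union> S) \<le> 2 + card S" for S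
    using card_Un_le[of "{i, j}" S] by (auto simp: card_insert_if split: if_splits)
  ultimately show ?case
    using v(3) le_trans[of "card ({i, j} \<union> trace t (xs @ [v]))" "2 + card (trace t (xs @ [v]))" "2 * k"]
    by (simp add: v(1))
next
  case (Test i t u)
  let ?t = "if xs ! i = 0 then t else u"
  obtain k' where k': "run ?t xs = Some (l, out, k')" "k = Suc k'"
    using Test.prems by (auto split: if_splits)
  have "finite (trace ?t xs) \<and> card (trace ?t xs) \<le> 2 * k'"
    using Test.IH k'(1) by (auto split: if_splits)
  moreover have "card (insert i S) \<le> 1 + card S" for S
    using card_Un_le[of "{i}" S] by simp
  moreover have "trace (Test i t u) xs = insert i (trace ?t xs)" by simp
  ultimately show ?case
    using k'(2) le_trans[of "card (insert i (trace ?t xs))" "1 + card (trace ?t xs)" "2 * k"] by simp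
qed (auto split: if_splits)

text \<open>Inputs that agree on the positions read along a path follow this path, and every value
  appended to the memory is the same for all of them.\<close>

lemma run_cong_trace:
  assumes "run t xs = Some (l, out, k)"
  shows "\<exists>ys js. \<forall>xs'. length xs' = length xs \<longrightarrow> (\<forall>i \<in> trace t xs. i < length xs \<longrightarrow> xs' ! i = xs ! i) \<longrightarrow>
    run t xs' = Some (l, map ((!) (xs' @ ys)) js, k) \<and> (\<forall>i\<in>set js. i < length (xs' @ ys))"
  using assms
proof (induction t arbitrary: xs k)
  case (Leaf l' js)
  then show ?case
    by (intro exI[of _ "[]"] exI[of _ js]) (auto split: if_splits)
next
  case (Const a t)
  then have "run t (xs @ [a]) = Some (l, out, k)" by simp
  from Const.IH[OF this] obtain ys js where *: "\<And>xs'. length xs' = length (xs @ [a]) \<Longrightarrow>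
      (\<forall>i \<in> trace t (xs @ [a]). i < length (xs @ [a]) \<longrightarrow> xs' ! i = (xs @ [a]) ! i) \<Longrightarrow>
      run t xs' = Some (l, map ((!) (xs' @ ys)) js, k) \<and> (\<forall>i\<in>set js. i < length (xs' @ ys))"
    by blast
  show ?case
  proof (intro exI[of _ "a # ys"] exI[of _ js] allI impI, goal_cases)
    case (1 xs')
    then show ?case using *[of "xs' @ [a]"] by (auto simp: nth_append less_Suc_eq)
  qed
next
  case (Arith f i j t)
  then obtain v k' where v: "arith f (xs ! i) (xs ! j) = Some v" "i < length xs" "j < length xs"
    "run t (xs @ [v]) = Some (l, out, k')" "k = Suc k'"
    by (auto split: if_splits option.splits)
  from Arith.IH[OF v(4)] obtain ys js where *: "\<And>xs'. length xs' = length (xs @ [v]) \<Longrightarrow>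
      (\<forall>i \<in> trace t (xs @ [v]). i < length (xs @ [v]) \<longrightarrow> xs' ! i = (xs @ [v]) ! i) \<Longrightarrow>
      run t xs' = Some (l, map ((!) (xs' @ ys)) js, k') \<and> (\<forall>i\<in>set js. i < length (xs' @ ys))"
    by blast
  show ?case
  proof (intro exI[of _ "v # ys"] exI[of _ js] allI impI, goal_cases)
    case (1 xs')
    then have "run t (xs' @ [v]) = Some (l, map ((!) ((xs' @ [v]) @ ys)) js, k') \<and>
       (\<forall>i\<in>set js. i < length ((xs' @ [v]) @ ys))"
      by (intro *) (auto simp: nth_append less_Suc_eq v(1))
    moreover have "arith f (xs' ! i) (xs' ! j) = Some v" using 1 v by simp
    ultimately show ?case using 1 v by simp
  qed
next
  case (Test i t u)
  let ?t = "if xs ! i = 0 then t else u"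
  obtain k' where k': "run ?t xs = Some (l, out, k')" "k = Suc k'" "i < length xs"
    using Test.prems by (auto split: if_splits)
  have "\<exists>ys js. \<forall>xs'. length xs' = length xs \<longrightarrow>
      (\<forall>i \<in> trace ?t xs. i < length xs \<longrightarrow> xs' ! i = xs ! i) \<longrightarrow>
      run ?t xs' = Some (l, map ((!) (xs' @ ys)) js, k') \<and> (\<forall>i\<in>set js. i < length (xs' @ ys))"
  proof (cases "xs ! i = 0")
    case True
    then show ?thesis using Test.IH(1)[of xs k'] k'(1) by simp
  next
    case False
    then show ?thesis using Test.IH(2)[of xs k'] k'(1) by simp
  qed
  then obtain ys js where *: "\<And>xs'. length xs' = length xs \<Longrightarrow>
      (\<forall>i \<in> trace ?t xs. i < length xs \<longrightarrow> xs' ! i = xs ! i) \<Longrightarrow>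
      run ?t xs' = Some (l, map ((!) (xs' @ ys)) js, k') \<and> (\<forall>i\<in>set js. i < length (xs' @ ys))"
    by blast
  show ?case
  proof (intro exI[of _ "ys"] exI[of _ js] allI impI, goal_cases)
    case (1 xs')
    then have "run ?t xs' = Some (l, map ((!) (xs' @ ys)) js, k') \<and>
       (\<forall>i\<in>set js. i < length (xs' @ ys))"
      by (intro *) (auto split: if_splits)
    moreover have "xs' ! i = xs ! i" using 1 k' by simp
    ultimately show ?case using 1 k' by (auto simp: if_distribR)
  qed
qed

lemma single_mult:
  assumes "i < n" "k < n"
  shows "(mat n n (\<lambda>p. if p = (i, k) then a else 0) * mat n n (\<lambda>p. if p = (k, i) then b else 0)) $$ (i, i)
    = a * (b :: 'a :: semiring_1)"
proof -
  have "(mat n n (\<lambda>p. if p = (i, k) then a else 0) * mat n n (\<lambda>p. if p = (k, i) then b else 0)) $$ (i, i)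
     = (\<Sum>l<n. (if l = k then a else 0) * (if l = k then b else 0))"
    using assms by (simp add: scalar_prod_def atLeast0LessThan)
  also have "\<dots> = (\<Sum>l<n. if l = k then a * b else 0)"
    by (rule sum.cong) auto
  finally show ?thesis using assms by simp
qed

lemma entries_single:
  assumes "i < n" "k < n" "p < n * n"
  shows "entries (mat n n (\<lambda>p. if p = (i, k) then a else 0)) ! p = (if p = i * n + k then a else 0)"
proof -
  have "p div n < n" "p mod n < n"
    using assms by (auto simp: less_mult_imp_div_less)
  moreover have "p div n = i \<and> p mod n = k \<longleftrightarrow> p = i * n + k"
    using assms by auto
  ultimately show ?thesis using assms unfolding entries_conv by auto
qed

text \<open>Every product \<open>A\<^sub>i\<^sub>k B\<^sub>k\<^sub>i\<close> forces the path of the zero input to read one of its two factors: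
  otherwise the output \<open>(AB)\<^sub>i\<^sub>i\<close> is, on the inputs that change only these two entries, either constant
  or a copy of a single input.\<close>

theorem matmul_lower_bound:
  assumes "matmul_within (K :: 'a :: field set) n t"
  shows "n * n \<le> 2 * t"
proof (rule ccontr)
  assume less: "\<not> n * n \<le> 2 * t"
  obtain P :: "(unit, 'a) ctree" where P: "\<And>A B. A \<in> carrier_mat n n \<Longrightarrow> B \<in> carrier_mat n n \<Longrightarrow>
    \<exists>k \<le> t. run P (entries A @ entries B) = Some ((), entries (A * B), k)"
    using assms unfolding matmul_within_def by blast
  define Z :: "'a list" where "Z = entries (0\<^sub>m n n) @ entries (0\<^sub>m n n)"
  obtain k' where k: "k' \<le> t" "run P Z = Some ((), entries (0\<^sub>m n n * 0\<^sub>m n n :: 'a mat), k')"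
    using P[of "0\<^sub>m n n" "0\<^sub>m n n"] unfolding Z_def by auto
  define S where "S = trace P Z"
  have S: "finite S" "card S \<le> 2 * t"
    using card_trace[OF k(2)] k(1) unfolding S_def by auto
  obtain i k where ik: "i < n" "k < n" "i * n + k \<notin> S" "n * n + (k * n + i) \<notin> S"
  proof (rule ccontr)
    note witness = that
    assume no: "\<not> thesis"
    have *: "i * n + k \<in> S \<or> n * n + (k * n + i) \<in> S" if "i < n" "k < n" for i k
      using that no witness by blast
    define g where "g = (\<lambda>(i, k). if i * n + k \<in> S then i * n + k else n * n + (k * n + i))"
    have eqD: "i = i' \<and> k = k'" if "i * n + k = i' * n + k'" "k < n" "k' < n" for i k i' k' :: nat
    proof -
      have "(i * n + k) div n = i" "(i * n + k) mod n = k" "(i' * n + k') div n = i'" "(i' * n + k') mod n = k'"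
        using that(2,3) by simp_all
      then show ?thesis using that(1) by metis
    qed
    have "inj_on g ({..<n} \<times> {..<n})"
    proof (rule inj_onI, clarify)
      fix i k i' k' assume l: "g (i, k) = g (i', k')" "i < n" "k < n" "i' < n" "k' < n"
      then show "i = i' \<and> k = k'"
        using eqD[of i k i' k'] eqD[of k i k' i'] index_less[of i n k n] index_less[of i' n k' n]
        unfolding g_def by (auto split: if_splits)
    qed
    moreover have "g x \<in> S" if "x \<in> {..<n} \<times> {..<n}" for x
      using that *[of "fst x" "snd x"] by (cases x) (auto simp: g_def)
    then have "g ` ({..<n} \<times> {..<n}) \<subseteq> S" by blast
    ultimately have "card ({..<n} \<times> {..<n}) \<le> card S"
      using S(1) by (meson card_inj_on_le)
    then show False using S(2) less by simp
  qed
  let ?A = "\<lambda>a. mat n n (\<lambda>p. if p = (i, k) then a else 0 :: 'a)"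
  let ?B = "\<lambda>b. mat n n (\<lambda>p. if p = (k, i) then b else 0 :: 'a)"
  let ?X = "\<lambda>a b. entries (?A a) @ entries (?B b)"
  have len: "length (?X a b) = length Z" for a b
    by (simp add: Z_def)
  have nth: "?X a b ! p = (if p = i * n + k then a else if p = n * n + (k * n + i) then b else 0)"
    if "p < n * n + n * n" for a b p
  proof (cases "p < n * n")
    case True
    then show ?thesis using ik(1,2) index_less[of k n i n]
      by (auto simp: nth_append entries_single)
  next
    case False
    then have "?X a b ! p = (if p - n * n = k * n + i then b else 0)"
      using that ik(1,2) entries_single[of k n i "p - n * n" b] by (simp add: nth_append)
    then show ?thesis using False ik(1,2) index_less[of i n k n] by auto
  qed
  obtain ys js where run: "\<And>xs'. length xs' = length Z \<Longrightarrow> (\<forall>i \<in> S. i < length Z \<longrightarrow> xs' ! i = Z ! i) \<Longrightarrow>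
    run P xs' = Some ((), map ((!) (xs' @ ys)) js, k') \<and> (\<forall>i\<in>set js. i < length (xs' @ ys))"
    using run_cong_trace[OF k(2)] unfolding S_def by blast
  have Z: "Z = ?X 0 0"
    unfolding Z_def zero_mat_def by simp
  have nthZ: "Z ! p = 0" if "p < n * n + n * n" for p
    using nth[OF that, of 0 0] by (simp only: Z if_cancel)
  have agree: "\<forall>p \<in> S. p < length Z \<longrightarrow> ?X a b ! p = Z ! p" for a b
  proof (intro ballI impI)
    fix p assume "p \<in> S" "p < length Z"
    then have "p < n * n + n * n" "p \<noteq> i * n + k" "p \<noteq> n * n + (k * n + i)"
      using ik(3,4) by (auto simp: Z_def)
    then show "?X a b ! p = Z ! p" by (simp only: nth nthZ if_False)
  qed
  have val: "(?X a b @ ys) ! (js ! (i * n + i)) = a * b" "length js = n * n" for a b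
  proof -
    have "run P (?X a b) = Some ((), map ((!) (?X a b @ ys)) js, k')"
      using run[OF len agree] by blast
    moreover obtain k'' where "run P (?X a b) = Some ((), entries (?A a * ?B b), k'')"
      using P[of "?A a" "?B b"] by auto
    ultimately have eq: "map ((!) (?X a b @ ys)) js = entries (?A a * ?B b)" by simp
    from arg_cong[OF eq, of length] show "length js = n * n" by simp
    with arg_cong[OF eq, of "\<lambda>l. l ! (i * n + i)"]
    show "(?X a b @ ys) ! (js ! (i * n + i)) = a * b"
      using ik single_mult[of i n k a b] nth_entries[of i "?A a * ?B b" i] index_less[of i n i n]
      by (simp del: index_mult_mat(1))
  qed
  let ?p = "js ! (i * n + i)"
  show False
  proof (cases "?p < n * n + n * n")
    case True
    \<comment> \<open>A copied input would be \<open>a * b\<close> for all \<open>a\<close> and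
      \<open>b\<close>. By a = b = 1 it is one of the two changed entries, but each of these is 1 in
      one of the cases (1, 0) and (0, 1), where the product is 0.\<close>
    then have "?X a b ! ?p = a * b" for a b
      using val(1)[of a b] nth_append_left[of ?p "?X a b" ys] by (simp del: append_assoc)
    from this[of 1 1] this[of 1 0] this[of 0 1] show False
      unfolding nth[OF True] by (auto split: if_splits)
  next
    case False
    then have "ys ! (?p - (n * n + n * n)) = a * b" for a b
      using val(1)[of a b] nth_append_right[of "?X a b" ?p ys] by (simp del: append_assoc)
    from this[of 1 1] this[of 0 0] show False by simp
  qed
qed


section \<open>Programs\<close>

text \<open>A tree whose label type is used for intermediate results is a monad: programs receive the
  current length of the memory, so that they know the position of the next value.\<close>

type_synonym ('l, 'a) prog = "nat \<Rightarrow> ('l, 'a) ctree"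

text \<open>Positions can be fixed when the tree is built: the length of the memory at a node
  depends only on the initial length and the path to the node, not on the values. \<open>N\<close>
  keeps count of it.\<close>

primrec graft :: "('l, 'a) ctree \<Rightarrow> nat \<Rightarrow> ('l \<Rightarrow> ('m, 'a) prog) \<Rightarrow> ('m, 'a) ctree" where
  "graft (Leaf l js) N c = c l N"
| "graft (Const a t) N c = Const a (graft t (Suc N) c)"
| "graft (Arith f i j t) N c = Arith f i j (graft t (Suc N) c)"
| "graft (Test i t u) N c = Test i (graft t N c) (graft u N c)"

definition bindP :: "('l, 'a) prog \<Rightarrow> ('l \<Rightarrow> ('m, 'a) prog) \<Rightarrow> ('m, 'a) prog" where
  "bindP p c N = graft (p N) N c"

definition retP :: "'l \<Rightarrow> ('l, 'a) prog" where
  "retP l N = Leaf l []"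

definition constP :: "'a \<Rightarrow> (nat, 'a) prog" where
  "constP a N = Const a (Leaf N [])"

definition arithP :: "arith_op \<Rightarrow> nat \<Rightarrow> nat \<Rightarrow> (nat, 'a) prog" where
  "arithP f i j N = Arith f i j (Leaf N [])"

definition is_zeroP :: "nat \<Rightarrow> (bool, 'a) prog" where
  "is_zeroP i N = Test i (Leaf True []) (Leaf False [])"

text \<open>Here \<open>\<sigma>\<close> maps the positions in the memory of the subroutine to those of the calling program.\<close>

primrec embedP :: "('l, 'a) ctree \<Rightarrow> nat list \<Rightarrow> (nat list, 'a) prog" where
  "embedP (Leaf l js) \<sigma> = retP (map ((!) \<sigma>) js)"
| "embedP (Const a t) \<sigma> = bindP (constP a) (\<lambda>p. embedP t (\<sigma> @ [p]))"
| "embedP (Arith f i j t) \<sigma> = bindP (arithP f (\<sigma> ! i) (\<sigma> ! j)) (\<lambda>p. embedP t (\<sigma> @ [p]))"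
| "embedP (Test i t u) \<sigma> = bindP (is_zeroP (\<sigma> ! i)) (\<lambda>b. if b then embedP t \<sigma> else embedP u \<sigma>)"

section \<open>Programs with constants in a given set\<close>

definition over :: "'a set \<Rightarrow> ('l, 'a) prog \<Rightarrow> bool" where
  "over K p \<longleftrightarrow> (\<forall>N. scalars (p N) \<subseteq> K)"

named_theorems over

lemma scalars_graft: "scalars t \<subseteq> K \<Longrightarrow> (\<And>l. over K (c l)) \<Longrightarrow> scalars (graft t N c) \<subseteq> K"
  by (induction t arbitrary: N) (auto simp: over_def)

lemma over_bindP [over]: "over K p \<Longrightarrow> (\<And>l. over K (c l)) \<Longrightarrow> over K (bindP p c)"
  by (simp add: over_def bindP_def scalars_graft)

lemma over_retP [over]: "over K (retP l)"
  by (simp add: over_def retP_def)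

lemma over_constP [over]: "a \<in> K \<Longrightarrow> over K (constP a)"
  by (simp add: over_def constP_def)

lemma over_arithP [over]: "over K (arithP f i j)"
  by (simp add: over_def arithP_def)

lemma over_is_zeroP [over]: "over K (is_zeroP i)"
  by (simp add: over_def is_zeroP_def)

lemma over_if [over]: "over K p \<Longrightarrow> over K q \<Longrightarrow> over K (if b then p else q)"
  by simp

lemma over_case_prod [over]: "(\<And>a b. over K (p a b)) \<Longrightarrow> over K (case x of (a, b) \<Rightarrow> p a b)"
  by (cases x) simp

lemma over_case_option [over]:
  "over K p \<Longrightarrow> (\<And>a. over K (q a)) \<Longrightarrow> over K (case x of None \<Rightarrow> p | Some a \<Rightarrow> q a)"
  by (cases x) simp_all

lemma over_embedP [over]: "scalars t \<subseteq> K \<Longrightarrow> over K (embedP t \<sigma>)"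
  by (induction t arbitrary: \<sigma>) (auto intro!: over)


text \<open>A weakest precondition for total correctness with a budget \<open>t\<close>: a division
  by zero, an access outside the memory or an exceeded budget makes it false. The postcondition sees
  the final memory, because a label can only name positions.\<close>

primrec wp :: "('l, 'a::field) ctree \<Rightarrow> 'a list \<Rightarrow> nat \<Rightarrow> ('l \<Rightarrow> 'a list \<Rightarrow> bool) \<Rightarrow> bool" where
  "wp (Leaf l js) xs t Q = Q l xs"
| "wp (Const a p) xs t Q = wp p (xs @ [a]) t Q"
| "wp (Arith f i j p) xs t Q = (i < length xs \<and> j < length xs \<and> t > 0 \<and>
     (case arith f (xs ! i) (xs ! j) of None \<Rightarrow> False | Some v \<Rightarrow> wp p (xs @ [v]) (t - 1) Q))"
| "wp (Test i p q) xs t Q = (i < length xs \<and> t > 0 \<and> (if xs ! i = 0 then wp p xs (t - 1) Q else wp q xs (t - 1) Q))"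

definition spec :: "('l, 'a::field) prog \<Rightarrow> 'a list \<Rightarrow> nat \<Rightarrow> ('l \<Rightarrow> 'a list \<Rightarrow> bool) \<Rightarrow> bool" where
  "spec p xs t Q = wp (p (length xs)) xs t Q"

text \<open>The memory is append-only, so the postconditions have to be compared on extensions of
  \<open>xs\<close> only. This is how facts about earlier values survive sequential
  composition.\<close>

lemma wp_mono:
  "wp p xs t Q \<Longrightarrow> t \<le> t' \<Longrightarrow> (\<And>l ys. Q l (xs @ ys) \<Longrightarrow> Q' l (xs @ ys)) \<Longrightarrow> wp p xs t' Q'"
proof (induction p arbitrary: xs t t')
  case (Leaf l js)
  then show ?case using Leaf(3)[of l "[]"] by simp
next
  case (Const a p)
  show ?case
    using Const.prems(1,2) Const.IH[of "xs @ [a]" t t'] Const.prems(3)[of _ "a # ys" for ys] by simp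
next
  case (Arith f i j p)
  show ?case
    using Arith.prems(1,2) Arith.IH[of "xs @ [v]" "t - 1" "t' - 1" for v] Arith.prems(3)[of _ "v # ys" for v ys]
    by (auto split: option.splits)
next
  case (Test i p q)
  show ?case
    using Test.prems(1,2) Test.IH(1)[of xs "t - 1" "t' - 1"] Test.IH(2)[of xs "t - 1" "t' - 1"] Test.prems(3)
    by (auto split: if_splits)
qed

lemma wp_graft:
  "wp p xs s (\<lambda>l ys. wp (c l (length ys)) ys t Q) \<Longrightarrow> wp (graft p (length xs) c) xs (s + t) Q"
proof (induction p arbitrary: xs s)
  case (Leaf l js)
  then show ?case by (auto elim: wp_mono)
next
  case (Const a p)
  then show ?case using Const.IH[of "xs @ [a]"] by simp
next
  case (Arith f i j p)
  then show ?case using Arith.IH[of "xs @ [v]" "s - 1" for v] by (auto split: option.splits)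
next
  case (Test i p q)
  then show ?case using Test.IH[of xs "s - 1"] by (auto split: if_splits)
qed

lemma spec_mono:
  "spec p xs t Q \<Longrightarrow> t \<le> t' \<Longrightarrow> (\<And>l ys. Q l (xs @ ys) \<Longrightarrow> Q' l (xs @ ys)) \<Longrightarrow> spec p xs t' Q'"
  unfolding spec_def by (rule wp_mono)

lemma spec_bindP:
  assumes "spec p xs s R" "\<And>l ys. R l (xs @ ys) \<Longrightarrow> spec (c l) (xs @ ys) t Q" "s + t \<le> u"
  shows "spec (bindP p c) xs u Q"
proof -
  have "wp (p (length xs)) xs s (\<lambda>l ys. wp (c l (length ys)) ys t Q)"
    using assms(1,2) unfolding spec_def by (auto elim: wp_mono)
  from wp_graft[OF this] show ?thesis
    using assms(3) unfolding spec_def bindP_def by (auto elim: wp_mono)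
qed

lemma spec_retP: "Q l xs \<Longrightarrow> spec (retP l) xs t Q"
  by (simp add: spec_def retP_def)

section \<open>Values and lists of values in memory\<close>

definition cell :: "'a list \<Rightarrow> nat \<Rightarrow> 'a \<Rightarrow> bool" where
  "cell xs i v \<longleftrightarrow> i < length xs \<and> xs ! i = v"

lemma cell_append: "cell xs i v \<Longrightarrow> cell (xs @ ys) i v"
  by (simp add: cell_def nth_append)

lemma spec_constP: "spec (constP a) xs 0 (\<lambda>p ys. cell ys p a)"
  by (simp add: spec_def constP_def cell_def)

lemma spec_arithP:
  "cell xs i a \<Longrightarrow> cell xs j b \<Longrightarrow> arith f a b = Some v \<Longrightarrow> spec (arithP f i j) xs 1 (\<lambda>p ys. cell ys p v)"
  by (simp add: spec_def arithP_def cell_def)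

lemma spec_is_zeroP: "cell xs i a \<Longrightarrow> spec (is_zeroP i) xs 1 (\<lambda>b ys. b \<longleftrightarrow> a = 0)"
  by (simp add: spec_def is_zeroP_def cell_def)

definition cells :: "'a list \<Rightarrow> nat list \<Rightarrow> 'a list \<Rightarrow> bool" where
  "cells xs js vs \<longleftrightarrow> list_all2 (cell xs) js vs"

lemma cells_append: "cells xs js vs \<Longrightarrow> cells (xs @ ys) js vs"
  unfolding cells_def by (erule list_all2_mono) (rule cell_append)

lemma cells_conv_nth: "cells xs js vs \<longleftrightarrow> length js = length vs \<and> (\<forall>i<length vs. cell xs (js ! i) (vs ! i))"
  unfolding cells_def by (auto simp: list_all2_conv_all_nth)

lemma cells_snoc: "cells xs js vs \<Longrightarrow> cell xs p v \<Longrightarrow> cells xs (js @ [p]) (vs @ [v])"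
  by (simp add: cells_def list_all2_appendI)

lemma spec_embedP:
  assumes "run t vs = Some (l, out, k)" "cells xs \<sigma> vs"
  shows "spec (embedP t \<sigma>) xs k (\<lambda>js ys. cells ys js out)"
  using assms
proof (induction t arbitrary: vs \<sigma> xs k)
  case (Leaf l js)
  then show ?case
    by (auto intro!: spec_retP simp: cells_conv_nth split: if_splits)
next
  case (Const a t)
  show ?case unfolding embedP.simps
  proof (rule spec_bindP[OF spec_constP, where t = k])
    fix p ys assume "cell (xs @ ys) p a"
    with Const.prems show "spec (embedP t (\<sigma> @ [p])) (xs @ ys) k (\<lambda>js ys. cells ys js out)"
      by (intro Const.IH[of "vs @ [a]"] cells_snoc cells_append) simp_all
  qed simp
next
  case (Arith f i j t)
  then obtain v k' where v: "arith f (vs ! i) (vs ! j) = Some v" "i < length vs" "j < length vs"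
    "run t (vs @ [v]) = Some (l, out, k')" "k = Suc k'"
    by (auto split: if_splits option.splits)
  have "cell xs (\<sigma> ! i) (vs ! i)" "cell xs (\<sigma> ! j) (vs ! j)"
    using v(2,3) Arith.prems(2) by (auto simp: cells_conv_nth)
  from spec_arithP[OF this v(1)] show ?case unfolding embedP.simps
  proof (rule spec_bindP[where t = k'])
    fix p ys assume "cell (xs @ ys) p v"
    with Arith.prems(2) v(4) show "spec (embedP t (\<sigma> @ [p])) (xs @ ys) k' (\<lambda>js ys. cells ys js out)"
      by (intro Arith.IH[of "vs @ [v]"] cells_snoc cells_append) simp_all
  qed (simp add: v(5))
next
  case (Test i t u)
  then obtain k' where k': "run (if vs ! i = 0 then t else u) vs = Some (l, out, k')" "k = Suc k'" "i < length vs"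
    by (auto split: if_splits)
  with Test.prems have "cell xs (\<sigma> ! i) (vs ! i)" by (auto simp: cells_conv_nth)
  from spec_is_zeroP[OF this] show ?case unfolding embedP.simps
  proof (rule spec_bindP[where t = k'])
    fix b ys assume "b \<longleftrightarrow> vs ! i = 0"
    then show "spec (if b then embedP t \<sigma> else embedP u \<sigma>) (xs @ ys) k' (\<lambda>js ys. cells ys js out)"
      using k'(1) Test.IH[OF _ cells_append[OF Test.prems(2)]] by (auto split: if_splits)
  qed (simp add: k'(2))
qed

text \<open>The way back to \<open>run\<close>: the final graft moves the positions from the label
  into the leaf, whose output list \<open>run\<close> evaluates for free.\<close>

lemma spec_run:
  assumes "spec p xs t (\<lambda>(l, js) ys. \<exists>out. cells ys js out \<and> R l out)"
  shows "\<exists>l out k. k \<le> t \<and> R l out \<and>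
    run (graft (p (length xs)) (length xs) (\<lambda>(l, js) N. Leaf l js)) xs = Some (l, out, k)"
proof -
  have "wp p xs t (\<lambda>(l, js) ys. \<exists>out. cells ys js out \<and> R l out) \<Longrightarrow> \<exists>l out k. k \<le> t \<and> R l out \<and>
    run (graft p (length xs) (\<lambda>(l, js) N. Leaf l js)) xs = Some (l, out, k)" for p
  proof (induction p arbitrary: xs t)
    case (Leaf l js)
    obtain l' js' where l: "l = (l', js')" by (cases l)
    with Leaf obtain out where out: "cells xs js' out" "R l' out" by auto
    then have "map ((!) xs) js' = out" "\<forall>i\<in>set js'. i < length xs"
      by (auto simp: cells_conv_nth cell_def in_set_conv_nth intro!: nth_equalityI)
    then show ?case using out l by auto
  next
    case (Const a p)
    then show ?case using Const.IH[of "xs @ [a]"] by simp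
  next
    case (Arith f i j p)
    then obtain v where v: "arith f (xs ! i) (xs ! j) = Some v" "i < length xs" "j < length xs" "t > 0"
      "wp p (xs @ [v]) (t - 1) (\<lambda>(l, js) ys. \<exists>out. cells ys js out \<and> R l out)"
      by (auto split: option.splits)
    then obtain l out k where "k \<le> t - 1" "R l out"
      "run (graft p (Suc (length xs)) (\<lambda>(l, js) N. Leaf l js)) (xs @ [v]) = Some (l, out, k)"
      using Arith.IH[of "xs @ [v]" "t - 1"] by auto
    then show ?case using v by (intro exI[of _ l] exI[of _ out] exI[of _ "Suc k"]) auto
  next
    case (Test i p q)
    let ?p = "if xs ! i = 0 then p else q"
    have v: "i < length xs" "t > 0" "wp ?p xs (t - 1) (\<lambda>(l, js) ys. \<exists>out. cells ys js out \<and> R l out)"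
      using Test.prems by auto
    then obtain l out k where "k \<le> t - 1" "R l out"
      "run (graft ?p (length xs) (\<lambda>(l, js) N. Leaf l js)) xs = Some (l, out, k)"
      using Test.IH[of xs "t - 1"] by (auto split: if_splits)
    then show ?case using v by (intro exI[of _ l] exI[of _ out] exI[of _ "Suc k"]) (auto split: if_splits)
  qed
  then show ?thesis using assms unfolding spec_def .
qed

primrec mapP :: "('b \<Rightarrow> ('l, 'a) prog) \<Rightarrow> 'b list \<Rightarrow> ('l list, 'a) prog" where
  "mapP f [] = retP []"
| "mapP f (b # bs) = bindP (f b) (\<lambda>l. bindP (mapP f bs) (\<lambda>ls. retP (l # ls)))"

lemma over_mapP [over]: "(\<And>b. over K (f b)) \<Longrightarrow> over K (mapP f bs)"
  by (induction bs) (auto intro!: over)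

text \<open>Values stored by earlier calls must outlive the later ones; hence \<open>R\<close> is
  required to be stable under appending to the memory.\<close>

lemma spec_mapP:
  assumes "\<And>b ys. b \<in> set bs \<Longrightarrow> spec (f b) (xs @ ys) t (\<lambda>l zs. R zs l b)"
    and mono: "\<And>ys zs l b. R ys l b \<Longrightarrow> R (ys @ zs) l b"
    and "length bs * t \<le> s"
  shows "spec (mapP f bs) xs s (\<lambda>ls ys. list_all2 (R ys) ls bs)"
  using assms(1,3)
proof (induction bs arbitrary: xs s)
  case Nil
  then show ?case by (auto intro: spec_retP)
next
  case (Cons b bs)
  have IH: "spec (mapP f bs) (xs @ ys) (length bs * t) (\<lambda>ls ys. list_all2 (R ys) ls bs)" for ys
    using Cons.prems(1) by (intro Cons.IH) auto
  have fst: "spec (f b) xs t (\<lambda>l zs. R zs l b)"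
    using Cons.prems(1)[of b "[]"] by simp
  show ?case unfolding mapP.simps
  proof (rule spec_bindP[OF fst, where t = "length bs * t"])
    fix l ys assume l: "R (xs @ ys) l b"
    show "spec (bindP (mapP f bs) (\<lambda>ls. retP (l # ls))) (xs @ ys) (length bs * t) (\<lambda>ls ys. list_all2 (R ys) ls (b # bs))"
    proof (rule spec_bindP[OF IH, where t = 0])
      fix ls zs assume "list_all2 (R ((xs @ ys) @ zs)) ls bs"
      then show "spec (retP (l # ls)) ((xs @ ys) @ zs) 0 (\<lambda>ls ys. list_all2 (R ys) ls (b # bs))"
        using mono[OF l, of zs] by (intro spec_retP) simp
    qed simp
  qed (use Cons.prems(2) in simp)
qed


section \<open>Submatrices\<close>

text \<open>This and the following operations are polymorphic because they act on matrices over the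
  field and, inside programs, on matrices of memory positions. On positions they are free of
  cost.\<close>

definition sel :: "nat list \<Rightarrow> 'b mat \<Rightarrow> 'b mat" where
  "sel I A = mat (length I) (dim_col A) (\<lambda>(i, j). A $$ (I ! i, j))"

definition hcat :: "'b mat \<Rightarrow> 'b mat \<Rightarrow> 'b mat" where
  "hcat A B = mat (dim_row A) (dim_col A + dim_col B)
     (\<lambda>(i, j). if j < dim_col A then A $$ (i, j) else B $$ (i, j - dim_col A))"

definition slice :: "nat \<Rightarrow> nat \<Rightarrow> 'b mat \<Rightarrow> 'b mat" where
  "slice a b A = mat (dim_row A) (b - a) (\<lambda>(i, j). A $$ (i, a + j))"

lemma sel_carrier [simp]: "A \<in> carrier_mat n c \<Longrightarrow> sel I A \<in> carrier_mat (length I) c"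
  by (auto simp: sel_def)

lemma sel_dim [simp]: "dim_row (sel I A) = length I" "dim_col (sel I A) = dim_col A"
  by (simp_all add: sel_def)

lemma sel_index [simp]: "i < length I \<Longrightarrow> j < dim_col A \<Longrightarrow> sel I A $$ (i, j) = A $$ (I ! i, j)"
  by (simp add: sel_def)

lemma hcat_carrier [simp]:
  "A \<in> carrier_mat n a \<Longrightarrow> B \<in> carrier_mat n b \<Longrightarrow> hcat A B \<in> carrier_mat n (a + b)"
  by (auto simp: hcat_def)

lemma hcat_dim [simp]: "dim_row (hcat A B) = dim_row A" "dim_col (hcat A B) = dim_col A + dim_col B"
  by (simp_all add: hcat_def)

lemma slice_carrier [simp]: "A \<in> carrier_mat n c \<Longrightarrow> slice a b A \<in> carrier_mat n (b - a)"
  by (auto simp: slice_def)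

lemma hcat_slice: "A \<in> carrier_mat n c \<Longrightarrow> b \<le> c \<Longrightarrow> hcat (slice 0 b A) (slice b c A) = A"
  by (auto simp: hcat_def slice_def)

lemma sel_mult:
  assumes "set I \<subseteq> {..<n}" "A \<in> carrier_mat n b" "B \<in> carrier_mat b c"
  shows "sel I (A * B) = sel I A * (B :: 'a :: semiring_0 mat)"
proof (rule eq_matI)
  fix i j assume ij: "i < dim_row (sel I A * B)" "j < dim_col (sel I A * B)"
  then have "I ! i < n" using assms(1) nth_mem by fastforce
  moreover have "row (sel I A) i = row A (I ! i)"
    using ij calculation assms by (intro eq_vecI) auto
  ultimately show "sel I (A * B) $$ (i, j) = (sel I A * B) $$ (i, j)"
    using ij assms by simp
qed (use assms in auto)

lemma sel_minus:
  assumes "set I \<subseteq> {..<n}" "A \<in> carrier_mat n c" "B \<in> carrier_mat n c"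
  shows "sel I (A - B) = sel I A - (sel I B :: 'a :: ab_group_add mat)"
proof (rule eq_matI)
  fix i j assume ij: "i < dim_row (sel I A - sel I B)" "j < dim_col (sel I A - sel I B)"
  then have "I ! i < n" using assms(1) nth_mem by fastforce
  then show "sel I (A - B) $$ (i, j) = (sel I A - sel I B) $$ (i, j)"
    using ij assms by simp
qed (use assms in auto)


section \<open>Column spaces\<close>

definition cs :: "'a::field mat \<Rightarrow> 'a vec set" where
  "cs A = {A *\<^sub>v x | x. x \<in> carrier_vec (dim_col A)}"

definition ssum :: "'a::plus vec set \<Rightarrow> 'a vec set \<Rightarrow> 'a vec set" (infixl "\<boxplus>" 65) where
  "S \<boxplus> T = {x + y | x y. x \<in> S \<and> y \<in> T}"

lemma cs_carrier: "A \<in> carrier_mat n c \<Longrightarrow> cs A \<subseteq> carrier_vec n"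
  by (auto simp: cs_def)

lemma csI: "A \<in> carrier_mat n c \<Longrightarrow> x \<in> carrier_vec c \<Longrightarrow> A *\<^sub>v x \<in> cs A"
  by (auto simp: cs_def)

lemma csE:
  assumes "v \<in> cs A" "A \<in> carrier_mat n c"
  obtains x where "x \<in> carrier_vec c" "v = A *\<^sub>v x"
  using assms by (auto simp: cs_def)

lemma ssumI: "x \<in> S \<Longrightarrow> y \<in> T \<Longrightarrow> x + y \<in> S \<boxplus> T"
  by (auto simp: ssum_def)

lemma ssumE:
  assumes "v \<in> S \<boxplus> T"
  obtains x y where "x \<in> S" "y \<in> T" "v = x + y"
  using assms by (auto simp: ssum_def)

lemma ssum_carrier: "S \<subseteq> carrier_vec n \<Longrightarrow> T \<subseteq> carrier_vec n \<Longrightarrow> S \<boxplus> T \<subseteq> carrier_vec n"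
  unfolding ssum_def by (blast intro: add_carrier_vec)

lemma ssum_commute: "S \<subseteq> carrier_vec n \<Longrightarrow> T \<subseteq> carrier_vec n \<Longrightarrow> S \<boxplus> T = T \<boxplus> (S :: 'a::field vec set)"
  unfolding ssum_def by (auto; metis comm_add_vec subsetD)

lemma ssum_assoc:
  assumes "S \<subseteq> carrier_vec n" "T \<subseteq> carrier_vec n" "U \<subseteq> carrier_vec n"
  shows "S \<boxplus> T \<boxplus> U = S \<boxplus> (T \<boxplus> (U :: 'a::field vec set))"
proof -
  have "x + y + z = x + (y + z)" if "x \<in> S" "y \<in> T" "z \<in> U" for x y z
    using that assms by (intro assoc_add_vec) auto
  then show ?thesis unfolding ssum_def by (auto; metis)
qed

lemma hcat_mult_vec:
  assumes "A \<in> carrier_mat n a" "B \<in> carrier_mat n b" "x \<in> carrier_vec a" "y \<in> carrier_vec b"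
  shows "hcat A B *\<^sub>v (x @\<^sub>v y) = A *\<^sub>v x + B *\<^sub>v (y :: 'a::field vec)"
proof (rule eq_vecI)
  fix i assume i: "i < dim_vec (A *\<^sub>v x + B *\<^sub>v y)"
  have "row (hcat A B) i = row A i @\<^sub>v row B i"
    using i assms by (intro eq_vecI) (auto simp: hcat_def)
  then show "(hcat A B *\<^sub>v (x @\<^sub>v y)) $ i = (A *\<^sub>v x + B *\<^sub>v y) $ i"
    using i assms by (auto simp: scalar_prod_append[of _ a _ b])
qed (use assms in auto)

lemma cs_hcat:
  assumes "A \<in> carrier_mat n a" "B \<in> carrier_mat n b"
  shows "cs (hcat A B) = cs A \<boxplus> cs B"
proof (intro equalityI subsetI)
  fix v assume "v \<in> cs (hcat A B)"
  then obtain x where x: "x \<in> carrier_vec (a + b)" "v = hcat A B *\<^sub>v x"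
    using assms by (auto elim: csE)
  have "x = vec_first x a @\<^sub>v vec_last x b"
    using vec_first_last_append[OF x(1)] by simp
  then have "v = A *\<^sub>v vec_first x a + B *\<^sub>v vec_last x b"
    using hcat_mult_vec[OF assms, of "vec_first x a" "vec_last x b"] x(2) by simp
  then show "v \<in> cs A \<boxplus> cs B"
    using assms by (auto intro!: ssumI csI)
next
  fix v assume "v \<in> cs A \<boxplus> cs B"
  then obtain x y where xy: "x \<in> carrier_vec a" "y \<in> carrier_vec b" "v = A *\<^sub>v x + B *\<^sub>v y"
    using assms by (auto elim!: ssumE csE)
  then have "v = hcat A B *\<^sub>v (x @\<^sub>v y)"
    using assms by (simp add: hcat_mult_vec)
  then show "v \<in> cs (hcat A B)"
    using xy assms by (auto intro!: csI)
qed

lemma mult_vec_minus_mult: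
  assumes "A \<in> carrier_mat n a" "B \<in> carrier_mat n b" "X \<in> carrier_mat b a"
    "x \<in> carrier_vec a" "y \<in> carrier_vec b"
  shows "(A - B * X) *\<^sub>v x + B *\<^sub>v y = A *\<^sub>v x + B *\<^sub>v (y - X *\<^sub>v x :: 'a::field vec)"
proof -
  have "(A - B * X) *\<^sub>v x = A *\<^sub>v x - B *\<^sub>v (X *\<^sub>v x)"
    using assms by (subst minus_mult_distrib_mat_vec[of _ n a]) auto
  moreover have "B *\<^sub>v (y - X *\<^sub>v x) = B *\<^sub>v y - B *\<^sub>v (X *\<^sub>v x)"
    using assms by (subst mult_minus_distrib_mat_vec[of _ n b]) auto
  ultimately show ?thesis using assms by (intro eq_vecI) auto
qed

text \<open>Column operations with the columns of \<open>B\<close>: replacing \<open>y\<close> by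
  \<open>y - X x\<close> is a bijection on the coordinates \<open>(x, y)\<close>.\<close>

lemma cs_minus_mult:
  assumes "A \<in> carrier_mat n a" "B \<in> carrier_mat n b" "X \<in> carrier_mat b a"
  shows "cs (A - B * X) \<boxplus> cs B = cs A \<boxplus> cs B"
proof (intro equalityI subsetI)
  have c: "A - B * X \<in> carrier_mat n a" using assms by (intro minus_carrier_mat mult_carrier_mat)
  {
    fix v assume "v \<in> cs (A - B * X) \<boxplus> cs B"
    then obtain x y where "x \<in> carrier_vec a" "y \<in> carrier_vec b" "v = (A - B * X) *\<^sub>v x + B *\<^sub>v y"
      using assms c by (metis csE ssumE)
    then show "v \<in> cs A \<boxplus> cs B"
      using assms by (auto simp: mult_vec_minus_mult intro!: ssumI csI)
  next
    fix v assume "v \<in> cs A \<boxplus> cs B"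
    then obtain x y where xy: "x \<in> carrier_vec a" "y \<in> carrier_vec b" "v = A *\<^sub>v x + B *\<^sub>v y"
      using assms by (metis csE ssumE)
    then have "v = (A - B * X) *\<^sub>v x + B *\<^sub>v (y + X *\<^sub>v x)"
      using assms by (subst mult_vec_minus_mult[OF assms]) (auto intro!: arg_cong[where f = "\<lambda>z. _ + _ *\<^sub>v z"])
    then show "v \<in> cs (A - B * X) \<boxplus> cs B"
      using xy(1,2) assms c by (auto intro!: ssumI csI)
  }
qed

lemma cs_col: "A \<in> carrier_mat n c \<Longrightarrow> j < c \<Longrightarrow> col A j \<in> cs A"
proof -
  assume A: "A \<in> carrier_mat n c" "j < c"
  then have "A *\<^sub>v unit_vec c j = col A j" by (intro eq_vecI) auto
  then show ?thesis using csI[OF A(1), of "unit_vec c j"] by simp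
qed

lemma cs_mult:
  assumes "A \<in> carrier_mat n b" "B \<in> carrier_mat b c"
  shows "cs (A * B) = (\<lambda>v. A *\<^sub>v v) ` cs B"
proof -
  have "A * B *\<^sub>v x = A *\<^sub>v (B *\<^sub>v x)" if "x \<in> carrier_vec c" for x
    using that assms by simp
  then show ?thesis
    using csI[OF assms(2)] csI[OF mult_carrier_mat[OF assms]] assms(2) mult_carrier_mat[OF assms]
    by (auto elim!: csE)
qed


section \<open>Reduced bases\<close>

text \<open>A reduced column echelon form up to the order of the rows. The identity block makes the
  columns independent, so \<open>length I\<close> is the dimension of \<open>cs G\<close> and stands
  in for it until \<open>krylov_dim_eq\<close>.\<close>

definition red_basis :: "nat \<Rightarrow> nat list \<Rightarrow> 'a::field mat \<Rightarrow> bool" where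
  "red_basis n I G \<longleftrightarrow> distinct I \<and> set I \<subseteq> {..<n} \<and> G \<in> carrier_mat n (length I) \<and> sel I G = 1\<^sub>m (length I)"

lemma red_basis_length: "red_basis n I G \<Longrightarrow> length I \<le> n"
  unfolding red_basis_def by (metis card_lessThan card_mono distinct_card finite_lessThan)

text \<open>A column of \<open>C\<close> is \<open>G x\<close> for some \<open>x\<close>, and in the
  rows \<open>I\<close> the vector \<open>G x\<close> is \<open>x\<close> itself. So coordinates are
  read off without solving a linear system.\<close>

lemma red_basis_eq:
  assumes "red_basis n I G" "C \<in> carrier_mat n c" "cs C \<subseteq> cs G"
  shows "G * sel I C = C"
proof (rule eq_matI)
  fix i j assume ij: "i < dim_row C" "j < dim_col C"
  have G: "G \<in> carrier_mat n (length I)" "sel I G = 1\<^sub>m (length I)" "set I \<subseteq> {..<n}"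
    using assms(1) by (auto simp: red_basis_def)
  have "col C j \<in> cs G" using ij assms cs_col by blast
  then obtain x where x: "x \<in> carrier_vec (length I)" "col C j = G *\<^sub>v x"
    using G by (auto elim: csE)
  have "col (sel I C) j = x"
  proof (rule eq_vecI)
    fix k assume k: "k < dim_vec x"
    then have "I ! k < n" using G x nth_mem by fastforce
    then have "col (sel I C) j $ k = (G *\<^sub>v x) $ (I ! k)"
      using k x ij assms(2) by (simp flip: x(2))
    also have "\<dots> = row (sel I G) k \<bullet> x"
    proof -
      have "row (sel I G) k = row G (I ! k)"
        using k x \<open>I ! k < n\<close> G(1) by (intro eq_vecI) auto
      then show ?thesis using \<open>I ! k < n\<close> G by simp
    qed
    also have "\<dots> = x $ k" using x k G by simp
    finally show "col (sel I C) j $ k = x $ k" .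
  qed (use x ij in auto)
  then have "(G * sel I C) $$ (i, j) = (G *\<^sub>v x) $ i"
    using ij G assms(2) by simp
  then show "(G * sel I C) $$ (i, j) = C $$ (i, j)"
    using ij by (simp flip: x(2))
qed (use assms in \<open>auto simp: red_basis_def\<close>)

text \<open>The reduced matrix \<open>C - G\<^sub>1 * sel I\<^sub>1 C\<close> vanishes in the rows
  \<open>I\<^sub>1\<close>, and so does \<open>G\<^sub>2\<close>, having the same column space.
  Hence clearing the rows \<open>I\<^sub>2\<close> of \<open>G\<^sub>1\<close> by means of
  \<open>G\<^sub>2\<close> leaves its rows \<open>I\<^sub>1\<close> intact, and both identity blocks
  survive side by side.\<close>

lemma red_basis_extend:
  fixes G\<^sub>1 :: "'a::field mat"
  assumes 1: "red_basis n I\<^sub>1 G\<^sub>1" and C: "C \<in> carrier_mat n c"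
    and 2: "red_basis n I\<^sub>2 G\<^sub>2" "cs G\<^sub>2 = cs (C - G\<^sub>1 * sel I\<^sub>1 C)"
  defines "G \<equiv> hcat (G\<^sub>1 - G\<^sub>2 * sel I\<^sub>2 G\<^sub>1) G\<^sub>2"
  shows "red_basis n (I\<^sub>1 @ I\<^sub>2) G" "cs G = cs G\<^sub>1 \<boxplus> cs C" "cs G = cs G\<^sub>1 \<boxplus> cs G\<^sub>2"
proof -
  have I: "set I\<^sub>1 \<subseteq> {..<n}" "set I\<^sub>2 \<subseteq> {..<n}" "distinct I\<^sub>1" "distinct I\<^sub>2"
    and G: "G\<^sub>1 \<in> carrier_mat n (length I\<^sub>1)" "G\<^sub>2 \<in> carrier_mat n (length I\<^sub>2)"
    and sel: "sel I\<^sub>1 G\<^sub>1 = 1\<^sub>m (length I\<^sub>1)" "sel I\<^sub>2 G\<^sub>2 = 1\<^sub>m (length I\<^sub>2)"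
    using 1 2(1) by (auto simp: red_basis_def)
  define C' where "C' = C - G\<^sub>1 * sel I\<^sub>1 C"
  have C': "C' \<in> carrier_mat n c" using C G(1) unfolding C'_def by (metis minus_carrier_mat mult_carrier_mat sel_carrier)
  define G' where "G' = G\<^sub>1 - G\<^sub>2 * sel I\<^sub>2 G\<^sub>1"
  have G': "G' \<in> carrier_mat n (length I\<^sub>1)" using G unfolding G'_def by (metis minus_carrier_mat mult_carrier_mat sel_carrier)
  have "sel I\<^sub>1 C' = 0\<^sub>m (length I\<^sub>1) c"
    unfolding C'_def using sel_minus[of I\<^sub>1 n C c "G\<^sub>1 * sel I\<^sub>1 C"] sel_mult[of I\<^sub>1 n G\<^sub>1 "length I\<^sub>1" "sel I\<^sub>1 C" c] I C G
    by (simp add: sel)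
  moreover have sel_zero: "sel I B = 0\<^sub>m (length I) b"
    if "B \<in> carrier_mat n b" "A \<in> carrier_mat n a" "cs B \<subseteq> cs A" "sel I A = 0\<^sub>m (length I) a" "set I \<subseteq> {..<n}"
    for I A B and a b
  proof (rule eq_matI)
    note prems = that
    fix i j assume ij: "i < dim_row (0\<^sub>m (length I) b)" "j < dim_col (0\<^sub>m (length I) b)"
    then have i: "I ! i < n" using that(5) nth_mem by fastforce
    have "col B j \<in> cs A" using cs_col[OF prems(1), of j] ij prems(3) by auto
    then obtain x where x: "x \<in> carrier_vec a" "col B j = A *\<^sub>v x"
      using prems(2) by (rule csE)
    have "row A (I ! i) = 0\<^sub>v a"
    proof (rule eq_vecI)
      fix k assume "k < dim_vec (0\<^sub>v a)"
      then have k: "k < a" by simp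
      have "sel I A $$ (i, k) = 0" unfolding prems(4) using ij k by simp
      then show "row A (I ! i) $ k = 0\<^sub>v a $ k" using k i ij prems(2) by simp
    qed (use prems(2) in auto)
    then have "(A *\<^sub>v x) $ (I ! i) = 0" using x(1) i prems(2) by simp
    moreover have "(A *\<^sub>v x) $ (I ! i) = B $$ (I ! i, j)"
      using i ij prems(1) by (simp flip: x(2))
    ultimately show "sel I B $$ (i, j) = 0\<^sub>m (length I) b $$ (i, j)"
      using ij that(1) by simp
  qed (use that in auto)
  ultimately have s12: "sel I\<^sub>1 G\<^sub>2 = 0\<^sub>m (length I\<^sub>1) (length I\<^sub>2)"
    using sel_zero[OF G(2) C' _ _ I(1)] 2(2) by (simp add: C'_def)
  have minus_zero: "1\<^sub>m k - 0\<^sub>m k k = (1\<^sub>m k :: 'a mat)" for k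
    by (rule eq_matI) auto
  have s11: "sel I\<^sub>1 G' = 1\<^sub>m (length I\<^sub>1)"
    unfolding G'_def using sel_minus[of I\<^sub>1 n G\<^sub>1 "length I\<^sub>1" "G\<^sub>2 * sel I\<^sub>2 G\<^sub>1"]
      sel_mult[of I\<^sub>1 n G\<^sub>2 "length I\<^sub>2" "sel I\<^sub>2 G\<^sub>1" "length I\<^sub>1"] I G
    by (simp add: sel s12 minus_zero)
  have s21: "sel I\<^sub>2 G' = 0\<^sub>m (length I\<^sub>2) (length I\<^sub>1)"
    unfolding G'_def using sel_minus[of I\<^sub>2 n G\<^sub>1 "length I\<^sub>1" "G\<^sub>2 * sel I\<^sub>2 G\<^sub>1"]
      sel_mult[of I\<^sub>2 n G\<^sub>2 "length I\<^sub>2" "sel I\<^sub>2 G\<^sub>1" "length I\<^sub>1"] I G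
    by (simp add: sel)
  \<comment> \<open>In a common row, \<open>G\<^sub>2\<close> would have an entry that is 0 by
    \<open>s12\<close> and 1 by its own identity block.\<close>
  have disj: "set I\<^sub>1 \<inter> set I\<^sub>2 = {}"
  proof (rule ccontr)
    assume "set I\<^sub>1 \<inter> set I\<^sub>2 \<noteq> {}"
    then obtain a b where "a < length I\<^sub>1" "b < length I\<^sub>2" "I\<^sub>1 ! a = I\<^sub>2 ! b"
      by (metis disjoint_iff in_set_conv_nth)
    then show False
      using arg_cong[OF s12, of "\<lambda>M. M $$ (a, b)"] arg_cong[OF sel(2), of "\<lambda>M. M $$ (b, b)"] G by simp
  qed
  have idx: "G' $$ (I\<^sub>1 ! i, j) = (if i = j then 1 else 0)" if "i < length I\<^sub>1" "j < length I\<^sub>1" for i j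
    using arg_cong[OF s11, of "\<lambda>M. M $$ (i, j)"] that G' by simp
  have idx2: "G' $$ (I\<^sub>2 ! i, j) = 0" if "i < length I\<^sub>2" "j < length I\<^sub>1" for i j
    using arg_cong[OF s21, of "\<lambda>M. M $$ (i, j)"] that G' by simp
  have idx3: "G\<^sub>2 $$ (I\<^sub>1 ! i, j) = 0" if "i < length I\<^sub>1" "j < length I\<^sub>2" for i j
    using arg_cong[OF s12, of "\<lambda>M. M $$ (i, j)"] that G by simp
  have idx4: "G\<^sub>2 $$ (I\<^sub>2 ! i, j) = (if i = j then 1 else 0)" if "i < length I\<^sub>2" "j < length I\<^sub>2" for i j
    using arg_cong[OF sel(2), of "\<lambda>M. M $$ (i, j)"] that G by simp
  have G_eq: "G = hcat G' G\<^sub>2" unfolding G_def G'_def ..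
  have G_carrier: "G \<in> carrier_mat n (length (I\<^sub>1 @ I\<^sub>2))"
    unfolding G_eq using hcat_carrier[OF G' G(2)] by simp
  have "sel (I\<^sub>1 @ I\<^sub>2) G = 1\<^sub>m (length (I\<^sub>1 @ I\<^sub>2))"
  proof (rule eq_matI)
    fix i j assume "i < dim_row (1\<^sub>m (length (I\<^sub>1 @ I\<^sub>2)))" "j < dim_col (1\<^sub>m (length (I\<^sub>1 @ I\<^sub>2)))"
    then have ij: "i < length I\<^sub>1 + length I\<^sub>2" "j < length I\<^sub>1 + length I\<^sub>2" by simp_all
    have "(I\<^sub>1 @ I\<^sub>2) ! i \<in> set (I\<^sub>1 @ I\<^sub>2)" using ij by (intro nth_mem) simp
    then have i: "(I\<^sub>1 @ I\<^sub>2) ! i < n" using I(1,2) by auto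
    have "sel (I\<^sub>1 @ I\<^sub>2) G $$ (i, j) = G $$ ((I\<^sub>1 @ I\<^sub>2) ! i, j)"
      using ij G_carrier by simp
    also have "\<dots> = (if j < length I\<^sub>1 then G' $$ ((I\<^sub>1 @ I\<^sub>2) ! i, j) else G\<^sub>2 $$ ((I\<^sub>1 @ I\<^sub>2) ! i, j - length I\<^sub>1))"
      using i ij G(2) G' unfolding G_eq by (simp add: hcat_def)
    also have "\<dots> = (if i = j then 1 else 0)"
    proof (cases "i < length I\<^sub>1")
      case True
      then show ?thesis using ij idx[of i j] idx3[of i "j - length I\<^sub>1"] by (auto simp: nth_append)
    next
      case False
      then show ?thesis using ij idx2[of "i - length I\<^sub>1" j] idx4[of "i - length I\<^sub>1" "j - length I\<^sub>1"]
        by (auto simp: nth_append)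
    qed
    finally show "sel (I\<^sub>1 @ I\<^sub>2) G $$ (i, j) = 1\<^sub>m (length (I\<^sub>1 @ I\<^sub>2)) $$ (i, j)" using ij by simp
  qed (use G_carrier in simp_all)
  then show "red_basis n (I\<^sub>1 @ I\<^sub>2) G"
    using I disj G_carrier unfolding red_basis_def by simp
  have "cs G = cs G' \<boxplus> cs G\<^sub>2" unfolding G_eq by (rule cs_hcat[OF G' G(2)])
  also have "\<dots> = cs G\<^sub>1 \<boxplus> cs G\<^sub>2" unfolding G'_def by (rule cs_minus_mult) (use G in auto)
  finally show *: "cs G = cs G\<^sub>1 \<boxplus> cs G\<^sub>2" .
  also have "\<dots> = cs C' \<boxplus> cs G\<^sub>1"
    unfolding 2(2) C'_def[symmetric] using cs_carrier[OF G(1)] cs_carrier[OF C'] by (rule ssum_commute)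
  also have "\<dots> = cs C \<boxplus> cs G\<^sub>1" unfolding C'_def by (rule cs_minus_mult) (use G C in auto)
  also have "\<dots> = cs G\<^sub>1 \<boxplus> cs C"
    using cs_carrier[OF C] cs_carrier[OF G(1)] by (rule ssum_commute)
  finally show "cs G = cs G\<^sub>1 \<boxplus> cs C" .
qed


section \<open>Existence of reduced bases\<close>

lemma cs_single:
  assumes "C \<in> carrier_mat n 1" "p < n" "C $$ (p, 0) \<noteq> 0"
  defines "G \<equiv> mat n 1 (\<lambda>(i, j). C $$ (i, 0) / C $$ (p, 0))"
  shows "red_basis n [p] G" "cs G = cs (C :: 'a::field mat)"
proof -
  let ?d = "C $$ (p, 0)"
  have G: "G \<in> carrier_mat n 1" by (simp add: G_def)
  have eq: "C *\<^sub>v x = G *\<^sub>v (?d \<cdot>\<^sub>v x)" "G *\<^sub>v x = C *\<^sub>v (inverse ?d \<cdot>\<^sub>v x)" if "x \<in> carrier_vec 1" for x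
    using that assms(1-3) by (intro eq_vecI; simp add: G_def scalar_prod_def field_simps)+
  show "cs G = cs C"
  proof (intro equalityI subsetI)
    fix v assume "v \<in> cs G"
    then obtain x where "x \<in> carrier_vec 1" "v = G *\<^sub>v x" using G by (rule csE)
    then show "v \<in> cs C" using csI[OF assms(1), of "inverse ?d \<cdot>\<^sub>v x"] by (simp add: eq(2))
  next
    fix v assume "v \<in> cs C"
    then obtain x where "x \<in> carrier_vec 1" "v = C *\<^sub>v x" using assms(1) by (rule csE)
    then show "v \<in> cs G" using csI[OF G, of "?d \<cdot>\<^sub>v x"] by (simp add: eq(1))
  qed
  have "sel [p] G = 1\<^sub>m (length [p])"
    using assms by (intro eq_matI) (auto simp: G_def)
  then show "red_basis n [p] G" using G assms by (simp add: red_basis_def)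
qed

lemma mult_mat_zero_vec: "A \<in> carrier_mat n c \<Longrightarrow> A *\<^sub>v 0\<^sub>v c = (0\<^sub>v n :: 'a::semiring_0 vec)"
  by (intro eq_vecI) auto

lemma zero_in_cs: "A \<in> carrier_mat n c \<Longrightarrow> 0\<^sub>v n \<in> cs A"
  using csI[of A n c "0\<^sub>v c"] mult_mat_zero_vec[of A n c] by simp

lemma cs_eq_zero:
  assumes "C \<in> carrier_mat n c" "\<And>i j. i < n \<Longrightarrow> j < c \<Longrightarrow> C $$ (i, j) = 0"
  shows "cs C = {0\<^sub>v n}"
proof -
  have "C = 0\<^sub>m n c" using assms by (intro eq_matI) auto
  then have "C *\<^sub>v x = 0\<^sub>v n" if "x \<in> carrier_vec c" for x using that by (intro eq_vecI) auto
  then have "cs C \<subseteq> {0\<^sub>v n}" using assms(1) by (auto elim!: csE)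
  then show ?thesis using zero_in_cs[OF assms(1)] by auto
qed

lemma red_basis_empty: "red_basis n [] (mat n 0 f)" "cs (mat n 0 f) = {0\<^sub>v n}"
  by (auto simp: red_basis_def intro!: cs_eq_zero[of _ n 0] eq_matI)

lemma ssum_zero: "S \<subseteq> carrier_vec n \<Longrightarrow> {0\<^sub>v n} \<boxplus> S = (S :: 'a::field vec set)"
proof -
  assume "S \<subseteq> carrier_vec n"
  then have "0\<^sub>v n + x = x" if "x \<in> S" for x using that by auto
  then show ?thesis by (auto elim!: ssumE) (metis insertI1 ssumI)
qed

text \<open>One column at a time. Programs build their bases by \<open>basisP\<close>; mere
  existence serves the counting of pivots in \<open>kry_chain\<close>.\<close>

lemma red_basis_exists:
  "C \<in> carrier_mat n c \<Longrightarrow> \<exists>I G. red_basis n I G \<and> cs G = cs (C :: 'a::field mat)"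
proof (induction c arbitrary: C)
  case 0
  then have "cs C = {0\<^sub>v n}" by (intro cs_eq_zero) auto
  then show ?case using red_basis_empty by blast
next
  case (Suc c)
  have single: "\<exists>I G. red_basis n I G \<and> cs G = cs D" if D: "D \<in> carrier_mat n 1" for D :: "'a mat"
  proof (cases "\<exists>p<n. D $$ (p, 0) \<noteq> 0")
    case True
    then show ?thesis using cs_single[OF D] by blast
  next
    case False
    then have "cs D = {0\<^sub>v n}" using D by (intro cs_eq_zero) auto
    then show ?thesis using red_basis_empty by blast
  qed
  have C: "slice 0 c C \<in> carrier_mat n c" "slice c (Suc c) C \<in> carrier_mat n 1"
    using slice_carrier[OF Suc.prems, of 0 c] slice_carrier[OF Suc.prems, of c "Suc c"] by auto
  obtain I\<^sub>1 G\<^sub>1 where 1: "red_basis n I\<^sub>1 G\<^sub>1" "cs G\<^sub>1 = cs (slice 0 c C)"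
    using Suc.IH[OF C(1)] by blast
  have "G\<^sub>1 \<in> carrier_mat n (length I\<^sub>1)" using 1(1) by (simp add: red_basis_def)
  then have "slice c (Suc c) C - G\<^sub>1 * sel I\<^sub>1 (slice c (Suc c) C) \<in> carrier_mat n 1"
    using C(2) by (intro minus_carrier_mat mult_carrier_mat) auto
  from single[OF this] obtain I\<^sub>2 G\<^sub>2 where 2: "red_basis n I\<^sub>2 G\<^sub>2"
    "cs G\<^sub>2 = cs (slice c (Suc c) C - G\<^sub>1 * sel I\<^sub>1 (slice c (Suc c) C))"
    by blast
  have "cs C = cs (slice 0 c C) \<boxplus> cs (slice c (Suc c) C)"
    using hcat_slice[OF Suc.prems, of c] cs_hcat[OF C] by simp
  then show ?case
    using red_basis_extend(1,2)[OF 1(1) C(2) 2] 1(2) by auto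
qed


section \<open>Krylov spaces\<close>

text \<open>The span of \<open>B\<close>, ..., \<open>A^(k-1) B\<close> in Horner form. Each space
  is a function of the previous one, so that the chain is constant from its first repetition
  on.\<close>

fun kry :: "'a::field mat \<Rightarrow> 'a mat \<Rightarrow> nat \<Rightarrow> 'a vec set" where
  "kry A B 0 = {0\<^sub>v (dim_row A)}"
| "kry A B (Suc k) = cs B \<boxplus> (\<lambda>v. A *\<^sub>v v) ` kry A B k"

lemma image_carrier: "A \<in> carrier_mat n n \<Longrightarrow> (\<lambda>v. A *\<^sub>v v) ` S \<subseteq> carrier_vec n"
  by (auto intro!: carrier_vecI)

lemma image_ssum:
  assumes "A \<in> carrier_mat n n" "S \<subseteq> carrier_vec n" "T \<subseteq> carrier_vec n"
  shows "(\<lambda>v. A *\<^sub>v v) ` (S \<boxplus> T) = (\<lambda>v. A *\<^sub>v v) ` S \<boxplus> (\<lambda>v. A *\<^sub>v v) ` T"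
proof -
  have eq: "A *\<^sub>v (x + y) = A *\<^sub>v x + A *\<^sub>v y" if "x \<in> S" "y \<in> T" for x y
    using that assms by (intro mult_add_distrib_mat_vec) auto
  show ?thesis
  proof (intro equalityI subsetI)
    fix v assume "v \<in> (\<lambda>v. A *\<^sub>v v) ` (S \<boxplus> T)"
    then obtain x y where "x \<in> S" "y \<in> T" "v = A *\<^sub>v x + A *\<^sub>v y"
      using eq by (auto elim!: ssumE)
    then show "v \<in> (\<lambda>v. A *\<^sub>v v) ` S \<boxplus> (\<lambda>v. A *\<^sub>v v) ` T" by (auto intro!: ssumI)
  next
    fix v assume "v \<in> (\<lambda>v. A *\<^sub>v v) ` S \<boxplus> (\<lambda>v. A *\<^sub>v v) ` T"
    then obtain x y where "x \<in> S" "y \<in> T" "v = A *\<^sub>v x + A *\<^sub>v y"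
      by (auto elim!: ssumE)
    then show "v \<in> (\<lambda>v. A *\<^sub>v v) ` (S \<boxplus> T)" using eq by (metis imageI ssumI)
  qed
qed

lemma pow_mat_Suc_left: "A \<in> carrier_mat n n \<Longrightarrow> A ^\<^sub>m Suc k = A * A ^\<^sub>m k"
proof (induction k)
  case (Suc k)
  have "A ^\<^sub>m Suc (Suc k) = A * A ^\<^sub>m k * A" using Suc by simp
  also have "\<dots> = A * (A ^\<^sub>m k * A)" using Suc.prems by (intro assoc_mult_mat) auto
  finally show ?case by simp
qed simp

lemma pow_mat_add: "A \<in> carrier_mat n n \<Longrightarrow> A ^\<^sub>m (h + k) = A ^\<^sub>m h * A ^\<^sub>m k"
proof (induction h)
  case (Suc h)
  have "A ^\<^sub>m (Suc h + k) = A * (A ^\<^sub>m h * A ^\<^sub>m k)"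
    using Suc pow_mat_Suc_left[OF Suc.prems, of "h + k"] by simp
  also have "\<dots> = A * A ^\<^sub>m h * A ^\<^sub>m k" using Suc.prems by (intro assoc_mult_mat[symmetric]) auto
  finally show ?case using pow_mat_Suc_left[OF Suc.prems, of h] by simp
qed simp

locale krylov =
  fixes A B :: "'a::field mat" and n m :: nat
  assumes A: "A \<in> carrier_mat n n" and B: "B \<in> carrier_mat n m"
begin

abbreviation "K \<equiv> kry A B"

lemma pow_carrier [simp]: "A ^\<^sub>m k \<in> carrier_mat n n"
  using A by (rule pow_carrier_mat)

lemma kry_carrier: "K k \<subseteq> carrier_vec n"
proof (induction k)
  case (Suc k)
  then show ?case
    using ssum_carrier[OF cs_carrier[OF B] image_carrier[OF A]] by simp
qed (use A in simp)

lemma kry_add: "K (h + k) = K h \<boxplus> (\<lambda>v. A ^\<^sub>m h *\<^sub>v v) ` K k"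
proof (induction h)
  case 0
  have "1\<^sub>m n *\<^sub>v v = v" if "v \<in> K k" for v using that kry_carrier[of k] by auto
  then have "(\<lambda>v. 1\<^sub>m n *\<^sub>v v) ` K k = K k" by force
  then show ?case using A ssum_zero[OF kry_carrier] by simp
next
  case (Suc h)
  let ?f = "\<lambda>M S. (\<lambda>v. M *\<^sub>v v) ` S"
  have "K (Suc h + k) = cs B \<boxplus> ?f A (K h \<boxplus> ?f (A ^\<^sub>m h) (K k))"
    using Suc by simp
  also have "\<dots> = cs B \<boxplus> (?f A (K h) \<boxplus> ?f A (?f (A ^\<^sub>m h) (K k)))"
    using image_ssum[OF A kry_carrier image_carrier[OF pow_carrier]] by simp
  also have "?f A (?f (A ^\<^sub>m h) (K k)) = ?f (A ^\<^sub>m Suc h) (K k)"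
    unfolding image_image pow_mat_Suc_left[OF A]
  proof (rule image_cong)
    fix v assume "v \<in> K k"
    then have "v \<in> carrier_vec n" using kry_carrier by blast
    then show "A *\<^sub>v (A ^\<^sub>m h *\<^sub>v v) = A * A ^\<^sub>m h *\<^sub>v v"
      using assoc_mult_mat_vec[OF A pow_carrier] by simp
  qed simp
  also have "cs B \<boxplus> (?f A (K h) \<boxplus> \<dots>) = K (Suc h) \<boxplus> \<dots>"
    using ssum_assoc[OF cs_carrier[OF B] image_carrier[OF A] image_carrier[OF pow_carrier[of "Suc h"]], of "K h" "K k"]
    by (simp del: pow_mat.simps)
  finally show ?case .
qed

text \<open>\<open>A ^\<^sub>m h\<close> maps \<open>K k\<close> to the sum of the images of
  \<open>K (k - h)\<close> and \<open>cs W\<close>. By \<open>kry_add\<close>, the first image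
  together with \<open>K h\<close> is just \<open>K k\<close>; only the second image is new.\<close>

lemma kry_step:
  assumes "h \<le> k" "W \<in> carrier_mat n w" "K k = K (k - h) \<boxplus> cs W"
  shows "K (k + h) = K k \<boxplus> cs (A ^\<^sub>m h * W)"
proof -
  let ?f = "\<lambda>S. (\<lambda>v. A ^\<^sub>m h *\<^sub>v v) ` S"
  have "K (k + h) = K h \<boxplus> ?f (K (k - h) \<boxplus> cs W)"
    using kry_add[of h k] assms(3) by (simp add: add.commute)
  also have "\<dots> = K h \<boxplus> (?f (K (k - h)) \<boxplus> ?f (cs W))"
    using image_ssum[OF pow_carrier kry_carrier cs_carrier[OF assms(2)]] by simp
  also have "\<dots> = K h \<boxplus> ?f (K (k - h)) \<boxplus> ?f (cs W)"
    using ssum_assoc[OF kry_carrier image_carrier[OF pow_carrier] image_carrier[OF pow_carrier]] by simp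
  also have "K h \<boxplus> ?f (K (k - h)) = K k"
    using kry_add[of h "k - h"] assms(1) by simp
  also have "?f (cs W) = cs (A ^\<^sub>m h * W)"
    using cs_mult[OF pow_carrier assms(2)] by simp
  finally show ?thesis .
qed

lemma kry_1: "K 1 = cs B"
proof -
  have "(\<lambda>v. A *\<^sub>v v) ` {0\<^sub>v n} = {0\<^sub>v n}" using mult_mat_zero_vec[OF A] by simp
  then have "K 1 = cs B \<boxplus> {0\<^sub>v n}" using A by simp
  also have "\<dots> = cs B"
    using ssum_commute[OF cs_carrier[OF B], of "{0\<^sub>v n}"] ssum_zero[OF cs_carrier[OF B]] by simp
  finally show ?thesis .
qed

lemma kry_Suc: "K (Suc k) = K k \<boxplus> cs (A ^\<^sub>m k * B)"
  using kry_add[of k 1] kry_1 cs_mult[OF pow_carrier B] by simp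

lemma kry_stable: "K (Suc j) = K j \<Longrightarrow> j \<le> k \<Longrightarrow> K k = K j"
proof (induction k)
  case (Suc k)
  show ?case
  proof (cases "j = Suc k")
    case False
    then have "K k = K j" using Suc by simp
    then have "K (Suc k) = K (Suc j)" by simp
    then show ?thesis using Suc.prems by simp
  qed simp
qed simp

text \<open>As long as the Krylov spaces grow, the number of pivots of a reduced basis grows, but there
  are only \<open>n\<close> rows.\<close>

lemma kry_chain:
  "(\<exists>j<k. K (Suc j) = K j) \<or> (\<exists>I G. red_basis n I G \<and> cs G = K k \<and> k \<le> length I)"
proof (induction k)
  case 0
  then show ?case using red_basis_empty A by (metis carrier_matD(1) kry.simps(1) le0)
next
  case (Suc k)
  show ?case
  proof (cases "\<exists>j<Suc k. K (Suc j) = K j")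
    case False
    then obtain I G where IG: "red_basis n I G" "cs G = K k" "k \<le> length I"
      using Suc by (metis less_Suc_eq)
    let ?C = "A ^\<^sub>m k * B"
    have C: "?C \<in> carrier_mat n m" using mult_carrier_mat[OF pow_carrier B] .
    have G: "G \<in> carrier_mat n (length I)" using IG(1) by (simp add: red_basis_def)
    have "?C - G * sel I ?C \<in> carrier_mat n m"
      using C G by (intro minus_carrier_mat mult_carrier_mat) auto
    from red_basis_exists[OF this] obtain I' G' where 2: "red_basis n I' G'" "cs G' = cs (?C - G * sel I ?C)"
      by blast
    note ext = red_basis_extend[OF IG(1) C 2]
    \<comment> \<open>Without a new pivot \<open>K (Suc k)\<close> would equal \<open>K k\<close>,
      against the assumption that the chain has grown at every step so far.\<close>
    have "I' \<noteq> []"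
    proof
      assume "I' = []"
      then have "G' \<in> carrier_mat n 0" using 2(1) by (simp add: red_basis_def)
      then have "cs G' = {0\<^sub>v n}" by (intro cs_eq_zero) auto
      then have "K k \<boxplus> cs ?C = K k"
        using ext(2,3) IG(2) ssum_zero[OF kry_carrier[of k]] ssum_commute[OF kry_carrier[of k], of "{0\<^sub>v n}"] by simp
      then show False using kry_Suc[of k] False by auto
    qed
    then have "Suc k \<le> length (I @ I')" using IG(3) by (cases I') auto
    moreover have "cs (hcat (G - G' * sel I' G) G') = K (Suc k)"
      using ext(2) IG(2) kry_Suc by simp
    ultimately show ?thesis using ext(1) by blast
  qed blast
qed

text \<open>One of the first \<open>n + 1\<close> steps is stationary, for otherwise there would be
  \<open>n + 1\<close> pivots in \<open>n\<close> rows. This takes the place of the Cayley-Hamilton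
  theorem.\<close>

lemma kry_eq:
  assumes "n \<le> k"
  shows "K k = K n"
proof -
  have "\<exists>j<Suc n. K (Suc j) = K j"
    using kry_chain[of "Suc n"] red_basis_length by (metis not_less_eq_eq)
  then obtain j where "j \<le> n" "K (Suc j) = K j" by (auto simp: less_Suc_eq_le)
  then show ?thesis using kry_stable[of j k] kry_stable[of j n] assms by simp
qed

lemma kry_invariant: "(\<lambda>v. A *\<^sub>v v) ` K n \<subseteq> K n"
proof
  fix v assume v: "v \<in> (\<lambda>v. A *\<^sub>v v) ` K n"
  then have "0\<^sub>v n + v \<in> K (Suc n)"
    using zero_in_cs[OF B] by (auto intro: ssumI)
  moreover have "0\<^sub>v n + v = v" using v image_carrier[OF A, of "K n"] by auto
  ultimately show "v \<in> K n" using kry_eq[of "Suc n"] by simp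
qed

lemma kry_mono: "h \<le> k \<Longrightarrow> K h \<subseteq> K k"
proof (induction k rule: dec_induct)
  case (step k)
  have "v \<in> K (Suc k)" if "v \<in> K k" for v
  proof -
    have "v + 0\<^sub>v n \<in> K (Suc k)"
      unfolding kry_Suc using that zero_in_cs[OF mult_carrier_mat[OF pow_carrier B]] by (rule ssumI)
    moreover have "v + 0\<^sub>v n = v" using that kry_carrier[of k] by auto
    ultimately show ?thesis by simp
  qed
  then show ?case using step by blast
qed simp

text \<open>The span of all the columns is \<open>cs G\<close> by two inclusions. The rank of
  \<open>G\<close> is \<open>length I\<close> because multiplication by \<open>G\<close> is
  injective: \<open>x\<close> is visible in the rows \<open>I\<close> of \<open>G x\<close>.\<close>

lemma krylov_dim_eq:
  assumes "red_basis n I G" "cs G = K n"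
  shows "vec_space.krylov_dim n A B = length I"
proof -
  interpret vec_space "TYPE('a)" n .
  have G: "G \<in> carrier_mat n (length I)" "sel I G = 1\<^sub>m (length I)" and I: "set I \<subseteq> {..<n}"
    using assms by (auto simp: red_basis_def)
  have span_cs: "span (set (cols M)) = cs M" if "M \<in> carrier_mat n c" for M c
    using col_space_eq[OF that] that cs_carrier[OF that] unfolding col_space_def cs_def by auto
  let ?X = "\<Union>k<n. set (cols (A ^\<^sub>m k * B))"
  have AB: "A ^\<^sub>m k * B \<in> carrier_mat n m" for k by (rule mult_carrier_mat[OF pow_carrier B])
  have X: "?X \<subseteq> carrier_vec n" using cols_dim[of "A ^\<^sub>m k * B" for k] AB by fastforce
  have "K k \<subseteq> span ?X" if "k \<le> n" for k
    using that
  proof (induction k)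
    case 0
    then show ?case using vectorspace.span_zero[OF vectorspace_axioms, of ?X] A by (simp add: module_vec_def)
  next
    case (Suc k)
    have "cs (A ^\<^sub>m k * B) \<subseteq> span ?X"
      unfolding span_cs[OF AB, symmetric] using Suc.prems by (intro span_is_monotone UN_upper) simp
    then show ?case using Suc X unfolding kry_Suc by (auto elim!: ssumE intro!: span_add1)
  qed
  moreover have "span ?X \<subseteq> K n"
  proof -
    have "set (cols (A ^\<^sub>m k * B)) \<subseteq> K n" if "k < n" for k
    proof
      fix v assume "v \<in> set (cols (A ^\<^sub>m k * B))"
      then have "v \<in> span (set (cols (A ^\<^sub>m k * B)))"
        using cols_dim[of "A ^\<^sub>m k * B"] AB[of k] carrier_matD(1)[OF AB[of k]] by (intro span_mem) auto
      then have v: "v \<in> cs (A ^\<^sub>m k * B)" using span_cs[OF AB] by simp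
      have "0\<^sub>v n + v \<in> K (Suc k)"
        unfolding kry_Suc using kry_mono[of 0 k] A v by (intro ssumI) auto
      moreover have "0\<^sub>v n + v = v" using cs_carrier[OF AB[of k]] v by auto
      ultimately show "v \<in> K n" using kry_mono[of "Suc k" n] that by auto
    qed
    then have "?X \<subseteq> span (set (cols G))" using assms(2) span_cs[OF G(1)] by auto
    then show ?thesis
      using span_subsetI[of "set (cols G)" ?X] cols_dim[of G] G(1) assms(2) span_cs[OF G(1)] by auto
  qed
  ultimately have "span ?X = span (set (cols G))"
    using assms(2) span_cs[OF G(1)] by auto
  then have "vec_space.krylov_dim n A B = rank G"
    unfolding krylov_dim_def rank_def by simp
  also have inj: "x = y" if "G *\<^sub>v x = G *\<^sub>v y" "x \<in> carrier_vec (length I)" "y \<in> carrier_vec (length I)" for x y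
  proof (rule eq_vecI)
    fix i assume "i < dim_vec y"
    then have i: "i < length I" using that by simp
    then have "I ! i < n" using I nth_mem by fastforce
    then have "row G (I ! i) = row (sel I G) i" using i G(1) by (intro eq_vecI) auto
    then have "row G (I ! i) = unit_vec (length I) i" using i by (simp add: G(2))
    then show "x $ i = y $ i"
      using arg_cong[OF that(1), of "\<lambda>v. v $ (I ! i)"] that(2,3) i \<open>I ! i < n\<close> G(1) by simp
  qed (use that in auto)
  \<comment> \<open>\<open>lin_indpt\<close> concerns the set of columns, so equal columns must be
    excluded first; they would be the images of two different unit vectors.\<close>
  have dist: "distinct (cols G)"
  proof (rule ccontr)
    assume "\<not> distinct (cols G)"
    then obtain i j where ij: "i < length I" "j < length I" "i \<noteq> j" "col G i = col G j"
      using G(1) by (auto simp: distinct_conv_nth)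
    have "G *\<^sub>v unit_vec (length I) k = col G k" if "k < length I" for k
      using that G(1) by (intro eq_vecI) auto
    then show False using inj[of "unit_vec (length I) i" "unit_vec (length I) j"] ij by auto
  qed
  have "rank G = length I"
  proof (rule lin_indpt_full_rank[OF G(1) dist], rule ccontr)
    assume "\<not> lin_indpt (set (cols G))"
    then obtain v where v: "v \<in> carrier_vec (length I)" "v \<noteq> 0\<^sub>v (length I)" "G *\<^sub>v v = 0\<^sub>v n"
      using lin_depE[OF G(1) _ dist] by blast
    then show False using inj[of v "0\<^sub>v (length I)"] mult_mat_zero_vec[OF G(1)] by simp
  qed
  finally show ?thesis .
qed

end


section \<open>The Kalman form of a reduced basis\<close>

definition pick :: "nat list \<Rightarrow> 'b mat \<Rightarrow> 'b mat" where
  "pick J A = mat (dim_row A) (length J) (\<lambda>(i, j). A $$ (i, J ! j))"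

lemma pick_carrier [simp]: "A \<in> carrier_mat n c \<Longrightarrow> pick J A \<in> carrier_mat n (length J)"
  by (auto simp: pick_def)

lemma pick_mult:
  assumes "A \<in> carrier_mat n b" "C \<in> carrier_mat b c" "set J \<subseteq> {..<c}"
  shows "pick J (A * C) = A * pick J (C :: 'a :: semiring_0 mat)"
proof (rule eq_matI)
  fix i j assume ij: "i < dim_row (A * pick J C)" "j < dim_col (A * pick J C)"
  then have j: "J ! j < c" using assms(3) nth_mem by (fastforce simp: pick_def)
  then have "col (pick J C) j = col C (J ! j)"
    using ij assms by (intro eq_vecI) (auto simp: pick_def)
  then show "pick J (A * C) $$ (i, j) = (A * pick J C) $$ (i, j)"
    using ij j assms by (simp add: pick_def)
qed (use assms in \<open>auto simp: pick_def\<close>)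

lemma pick_one: "A \<in> carrier_mat n n \<Longrightarrow> set J \<subseteq> {..<n} \<Longrightarrow> A * pick J (1\<^sub>m n) = pick J (A :: 'a :: semiring_1 mat)"
  using pick_mult[of A n n "1\<^sub>m n" n J] by simp

lemma hcat_conv_four_block:
  "A \<in> carrier_mat n a \<Longrightarrow> B \<in> carrier_mat n b \<Longrightarrow> hcat A B = four_block_mat A B (0\<^sub>m 0 a) (0\<^sub>m 0 b)"
  by (intro eq_matI) (auto simp: hcat_def)

lemma mult_hcat:
  assumes "A \<in> carrier_mat n b" "C \<in> carrier_mat b c" "D \<in> carrier_mat b d"
  shows "A * hcat C D = hcat (A * C) (A * D :: 'a :: semiring_0 mat)"
proof (rule eq_matI)
  fix i j assume ij: "i < dim_row (hcat (A * C) (A * D))" "j < dim_col (hcat (A * C) (A * D))"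
  then have "col (hcat C D) j = (if j < c then col C j else col D (j - c))"
    using assms by (intro eq_vecI) (auto simp: hcat_def)
  then show "(A * hcat C D) $$ (i, j) = hcat (A * C) (A * D) $$ (i, j)"
    using ij assms by (auto simp: hcat_def)
qed (use assms in auto)

lemma hcat_mult_four_block:
  assumes "A1 \<in> carrier_mat n a" "A2 \<in> carrier_mat n b"
    "P \<in> carrier_mat a c" "Q \<in> carrier_mat a d" "R \<in> carrier_mat b c" "S \<in> carrier_mat b d"
  shows "hcat A1 A2 * four_block_mat P Q R S = hcat (A1 * P + A2 * R) (A1 * Q + A2 * S :: 'a :: ring mat)"
proof -
  have "hcat A1 A2 * four_block_mat P Q R S = four_block_mat (A1 * P + A2 * R) (A1 * Q + A2 * S)
    (0\<^sub>m 0 a * P + 0\<^sub>m 0 b * R) (0\<^sub>m 0 a * Q + 0\<^sub>m 0 b * S)"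
    unfolding hcat_conv_four_block[OF assms(1,2)] by (rule mult_four_block_mat) (use assms in auto)
  also have "0\<^sub>m 0 a * P + 0\<^sub>m 0 b * R = 0\<^sub>m 0 c" using assms by (intro eq_matI) auto
  also have "0\<^sub>m 0 a * Q + 0\<^sub>m 0 b * S = 0\<^sub>m 0 d" using assms by (intro eq_matI) auto
  finally show ?thesis
    by (subst hcat_conv_four_block[of _ n c _ d]) (use assms in \<open>auto intro!: add_carrier_mat mult_carrier_mat\<close>)
qed

lemma hcat_mult_append_rows:
  assumes "A1 \<in> carrier_mat n a" "A2 \<in> carrier_mat n b" "P \<in> carrier_mat a c" "R \<in> carrier_mat b c"
  shows "hcat A1 A2 * (P @\<^sub>r R) = A1 * P + (A2 * R :: 'a :: ring mat)"
proof -
  have "hcat A1 A2 * four_block_mat P (0\<^sub>m a 0) R (0\<^sub>m b 0)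
     = hcat (A1 * P + A2 * R) (A1 * 0\<^sub>m a 0 + A2 * 0\<^sub>m b 0)"
    using assms by (intro hcat_mult_four_block) auto
  also have "\<dots> = A1 * P + A2 * R"
    using assms by (intro eq_matI) (auto simp: hcat_def)
  finally show ?thesis using assms by (simp add: append_rows_def)
qed

locale completion =
  fixes n :: nat and I J :: "nat list" and G :: "'a::field mat"
  assumes red: "red_basis n I G" and J: "distinct J" "set J = {..<n} - set I"
begin

abbreviation "r \<equiv> length I"
abbreviation "E \<equiv> pick J (1\<^sub>m n) :: 'a mat"
abbreviation "T \<equiv> hcat G E"

lemma G: "G \<in> carrier_mat n r" "sel I G = 1\<^sub>m r" "set I \<subseteq> {..<n}" "distinct I"
  using red by (auto simp: red_basis_def)

lemma lengths: "r + length J = n"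
proof -
  have "card (set J) = n - card (set I)" unfolding J(2) using G(3) by (subst card_Diff_subset) auto
  then show ?thesis
    using distinct_card[OF J(1)] distinct_card[OF G(4)] red_basis_length[OF red] by simp
qed

lemma E: "E \<in> carrier_mat n (length J)" "sel I E = 0\<^sub>m r (length J)" "sel J E = 1\<^sub>m (length J)"
proof -
  have nth: "I ! i \<in> set I" "I ! i < n" if "i < r" for i using that G(3) nth_mem by auto
  have nth': "J ! i \<in> set J" "J ! i < n" "J ! i \<notin> set I" if "i < length J" for i
    using that J(2) nth_mem[of i J] by auto
  show "E \<in> carrier_mat n (length J)" by (rule pick_carrier[OF one_carrier_mat])
  have neq: "I ! i \<noteq> J ! j" if "i < r" "j < length J" for i j
    using nth(1)[OF that(1)] nth'(3)[OF that(2)] by metis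
  show "sel I E = 0\<^sub>m r (length J)"
    using nth(2) nth'(2) neq by (intro eq_matI) (auto simp: pick_def)
  show "sel J E = 1\<^sub>m (length J)"
    using nth' J(1) by (intro eq_matI) (auto simp: pick_def nth_eq_iff_index_eq)
qed

lemma T: "T \<in> carrier_mat n n"
  using hcat_carrier[OF G(1) E(1)] lengths by simp

lemma eq_by_sel:
  assumes "M \<in> carrier_mat n c" "N \<in> carrier_mat n c" "sel I M = sel I N" "sel J M = sel J N"
  shows "M = N"
proof (rule eq_matI)
  fix i j assume ij: "i < dim_row N" "j < dim_col N"
  have eq: "M $$ (L ! p, j) = N $$ (L ! p, j)" if "p < length L" "sel L M = sel L N" for p L
    using arg_cong[OF that(2), of "\<lambda>A. A $$ (p, j)"] that(1) ij assms(1,2) by simp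
  have "i \<in> set I \<or> i \<in> set J" using ij assms(2) J(2) by auto
  then show "M $$ (i, j) = N $$ (i, j)"
    using eq assms(3,4) by (auto simp: in_set_conv_nth)
qed (use assms in auto)

lemma sel_add:
  assumes "set L \<subseteq> {..<n}" "M \<in> carrier_mat n c" "N \<in> carrier_mat n c"
  shows "sel L (M + N) = sel L M + sel L (N :: 'a mat)"
proof (rule eq_matI)
  fix i j assume ij: "i < dim_row (sel L M + sel L N)" "j < dim_col (sel L M + sel L N)"
  then have "L ! i < n" using assms(1) nth_mem by fastforce
  then show "sel L (M + N) $$ (i, j) = (sel L M + sel L N) $$ (i, j)"
    using ij assms by simp
qed (use assms in auto)

text \<open>This applies the inverse of \<open>T\<close> in closed form. In the rows
  \<open>I\<close>, \<open>G\<close> is the identity and \<open>E\<close> vanishes, which determines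
  the factor of \<open>G\<close>; in the rows \<open>J\<close>, \<open>E\<close> is the identity, so
  its factor is what \<open>G\<close> leaves of \<open>M\<close> there.\<close>

lemma decompose:
  assumes M: "M \<in> carrier_mat n c"
  shows "G * sel I M + E * (sel J M - sel J G * sel I M) = M"
proof -
  let ?X = "sel I M" and ?Y = "sel J M - sel J G * sel I M"
  have X: "?X \<in> carrier_mat r c" and Y: "?Y \<in> carrier_mat (length J) c"
    using M G(1) by (auto intro!: minus_carrier_mat mult_carrier_mat)
  have GX: "G * ?X \<in> carrier_mat n c" and EY: "E * ?Y \<in> carrier_mat n c"
    using mult_carrier_mat[OF G(1) X] mult_carrier_mat[OF E(1) Y] by auto
  have J': "set J \<subseteq> {..<n}" using J(2) by auto
  have "sel I (G * ?X + E * ?Y) = sel I M"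
    unfolding sel_add[OF G(3) GX EY] sel_mult[OF G(3) G(1) X] sel_mult[OF G(3) E(1) Y] G(2) E(2)
    using X Y M by simp
  moreover have "sel J (G * ?X + E * ?Y) = sel J M"
    unfolding sel_add[OF J' GX EY] sel_mult[OF J' G(1) X] sel_mult[OF J' E(1) Y] E(3)
    using X Y M G(1) by (intro eq_matI) auto
  ultimately show ?thesis using GX EY M by (intro eq_by_sel[OF _ M]) auto
qed

lemma T_inverse: "\<exists>T' \<in> carrier_mat n n. T * T' = 1\<^sub>m n \<and> T' * T = 1\<^sub>m n"
proof -
  let ?X = "sel I (1\<^sub>m n) :: 'a mat" and ?Y = "sel J (1\<^sub>m n) - sel J G * sel I (1\<^sub>m n) :: 'a mat"
  have X: "?X \<in> carrier_mat r n" and Y: "?Y \<in> carrier_mat (length J) n"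
    using G(1) by (auto intro!: minus_carrier_mat mult_carrier_mat)
  have T': "?X @\<^sub>r ?Y \<in> carrier_mat n n"
    using carrier_append_rows[OF X Y] lengths by simp
  have "T * (?X @\<^sub>r ?Y) = 1\<^sub>m n"
    using hcat_mult_append_rows[OF G(1) E(1) X Y] decompose[of "1\<^sub>m n" n] by simp
  with mat_mult_left_right_inverse[OF T T'] T' show ?thesis by blast
qed

end

text \<open>Since \<open>cs G\<close> is invariant and contains the columns of \<open>B\<close>,
  both \<open>A * G\<close> and \<open>B\<close> equal \<open>G\<close> times their rows
  \<open>I\<close>. This gives \<open>H\<close>, \<open>B\<^sub>1\<close> and the zero blocks. The
  product of \<open>A\<close> and \<open>E\<close> consists of the columns \<open>J\<close> of
  \<open>A\<close>, which \<open>decompose\<close> splits into \<open>X\<close> and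
  \<open>Y\<close>.\<close>

lemma kalman_form:
  assumes "krylov A B n m" "completion n I J G" "cs G = kry A B n"
  shows "is_kalman_form n m A B (length I) (hcat G (pick J (1\<^sub>m n))) (sel I A * G) (sel I (pick J A))
    (sel J (pick J A) - sel J G * sel I (pick J A)) (sel I B)"
proof -
  interpret krylov A B n m by fact
  interpret completion n I J G by fact
  let ?H = "sel I A * G" and ?X = "sel I (pick J A)" and ?Y = "sel J (pick J A) - sel J G * sel I (pick J A)"
    and ?B = "sel I B"
  have len: "length J = n - r" using lengths by simp
  have PA: "pick J A \<in> carrier_mat n (length J)" using A by simp
  have c: "?H \<in> carrier_mat r r" "?X \<in> carrier_mat r (length J)" "?Y \<in> carrier_mat (length J) (length J)"
    "?B \<in> carrier_mat r m"
    using A B G(1) sel_carrier[OF PA] by (auto intro!: minus_carrier_mat mult_carrier_mat)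
  obtain T' where T': "T' \<in> carrier_mat n n" "T * T' = 1\<^sub>m n" "T' * T = 1\<^sub>m n"
    using T_inverse by blast
  have cancel: "T' * (T * M) = M" if "M \<in> carrier_mat n k" for M and k
    using assoc_mult_mat[OF T'(1) T that] that by (simp add: T'(3))
  have AG: "A * G \<in> carrier_mat n r" using mult_carrier_mat[OF A G(1)] .
  have "cs (A * G) \<subseteq> cs G"
    unfolding cs_mult[OF A G(1)] assms(3) by (rule kry_invariant)
  from red_basis_eq[OF red AG this] have GH: "G * ?H = A * G"
    using sel_mult[OF G(3) A G(1)] by simp
  have "cs B \<subseteq> cs G"
    unfolding assms(3) using kry_1 kry_mono[of 1 n] B A
  \<comment> \<open>\<open>kry_mono\<close> puts \<open>K 1\<close> into \<open>K n\<close> only for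
    n \<ge> 1; for n = 0 there is only the zero vector.\<close>
  proof (cases "n = 0")
    case True
    then show "cs B \<subseteq> kry A B n" using cs_eq_zero[OF B] A by simp
  qed auto
  from red_basis_eq[OF red B this] have GB: "G * ?B = B" .
  have block: "four_block_mat ?H ?X (0\<^sub>m (length J) r) ?Y \<in> carrier_mat n n"
    using four_block_carrier_mat[OF c(1) c(3), of ?X "0\<^sub>m (length J) r"] lengths by simp
  have AT: "A * T = T * four_block_mat ?H ?X (0\<^sub>m (length J) r) ?Y"
  proof -
    have "T * four_block_mat ?H ?X (0\<^sub>m (length J) r) ?Y
      = hcat (G * ?H + E * 0\<^sub>m (length J) r) (G * ?X + E * ?Y)"
      using c G(1) E(1) by (intro hcat_mult_four_block) auto
    also have "G * ?H + E * 0\<^sub>m (length J) r = A * G"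
      unfolding GH using AG E(1) by simp
    also have "G * ?X + E * ?Y = pick J A" by (rule decompose[OF PA])
    also have "hcat (A * G) (pick J A) = A * T"
      using mult_hcat[OF A G(1) E(1)] pick_one[OF A, of J] J(2) by auto
    finally show ?thesis by simp
  qed
  have TB: "T * (?B @\<^sub>r 0\<^sub>m (length J) m) = B"
    using hcat_mult_append_rows[OF G(1) E(1) c(4), of "0\<^sub>m (length J) m"] GB E(1) B by simp
  have "T' * A * T = four_block_mat ?H ?X (0\<^sub>m (length J) r) ?Y"
    using assoc_mult_mat[OF T'(1) A T] AT cancel[OF block] by simp
  moreover have "T' * B = ?B @\<^sub>r 0\<^sub>m (length J) m"
    using cancel[of "?B @\<^sub>r 0\<^sub>m (length J) m" m] carrier_append_rows[OF c(4), of "0\<^sub>m (length J) m" "length J"] lengths TB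
    by simp
  ultimately show ?thesis
    unfolding is_kalman_form_def inverts_mat_def
    using krylov_dim_eq[OF red assms(3)] c T T' len by (auto intro!: exI[of _ T'])
qed


section \<open>Matrices in memory\<close>

definition holds :: "'a list \<Rightarrow> nat mat \<Rightarrow> 'a mat \<Rightarrow> bool" where
  "holds xs P M \<longleftrightarrow> dim_row P = dim_row M \<and> dim_col P = dim_col M \<and>
     (\<forall>i<dim_row M. \<forall>j<dim_col M. cell xs (P $$ (i, j)) (M $$ (i, j)))"

lemma holds_dim: "holds xs P M \<Longrightarrow> M \<in> carrier_mat a b \<Longrightarrow> dim_row P = a \<and> dim_col P = b"
  by (auto simp: holds_def)

lemma holds_cell: "holds xs P M \<Longrightarrow> M \<in> carrier_mat a b \<Longrightarrow> i < a \<Longrightarrow> j < b \<Longrightarrow> cell xs (P $$ (i, j)) (M $$ (i, j))"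
  by (auto simp: holds_def)

lemma holds_append: "holds xs P M \<Longrightarrow> holds (xs @ ys) P M"
  by (auto simp: holds_def cell_append)

lemma holds_append2: "holds xs P M \<Longrightarrow> holds (xs @ ys @ zs) P M"
  by (auto simp: holds_def cell_append)

lemma holds_sel: "holds xs P M \<Longrightarrow> M \<in> carrier_mat a b \<Longrightarrow> set I \<subseteq> {..<a} \<Longrightarrow> holds xs (sel I P) (sel I M)"
  unfolding holds_def by (auto, metis lessThan_iff nth_mem subsetD)

lemma holds_pick: "holds xs P M \<Longrightarrow> M \<in> carrier_mat a b \<Longrightarrow> set J \<subseteq> {..<b} \<Longrightarrow> holds xs (pick J P) (pick J M)"
  unfolding holds_def by (auto simp: pick_def, metis lessThan_iff nth_mem subsetD)

lemma holds_hcat: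
  "holds xs P M \<Longrightarrow> holds xs Q N \<Longrightarrow> dim_row M = dim_row N \<Longrightarrow> holds xs (hcat P Q) (hcat M N)"
  by (auto simp: holds_def hcat_def)

lemma holds_slice: "holds xs P M \<Longrightarrow> b \<le> dim_col M \<Longrightarrow> holds xs (slice a b P) (slice a b M)"
  by (auto simp: holds_def slice_def)

lemma holds_entries: "holds xs P M \<Longrightarrow> cells xs (entries P) (entries M)"
proof -
  assume P: "holds xs P M"
  have "p div dim_col M < dim_row M \<and> p mod dim_col M < dim_col M" if "p < dim_row M * dim_col M" for p
    using that by (cases "dim_col M = 0") (auto simp: less_mult_imp_div_less)
  then show ?thesis using P unfolding entries_conv cells_conv_nth by (auto simp: holds_def)
qed

definition matP :: "nat \<Rightarrow> nat \<Rightarrow> (nat \<Rightarrow> nat \<Rightarrow> (nat, 'a) prog) \<Rightarrow> (nat mat, 'a) prog" where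
  "matP a b f = bindP (mapP (\<lambda>p. f (p div b) (p mod b)) [0..<a * b])
     (\<lambda>l. retP (mat a b (\<lambda>(i, j). l ! (i * b + j))))"

lemma over_matP [over]: "(\<And>i j. over K (f i j)) \<Longrightarrow> over K (matP a b f)"
  unfolding matP_def by (intro over)

lemma spec_matP:
  assumes "\<And>i j ys. i < a \<Longrightarrow> j < b \<Longrightarrow> spec (f i j) (xs @ ys) t (\<lambda>p zs. cell zs p (M $$ (i, j)))"
    and "M \<in> carrier_mat a b" "a * b * t \<le> s"
  shows "spec (matP a b f) xs s (\<lambda>P ys. holds ys P M)"
  unfolding matP_def
proof (rule spec_bindP[where t = 0])
  show "spec (mapP (\<lambda>p. f (p div b) (p mod b)) [0..<a * b]) xs s
    (\<lambda>l ys. list_all2 (\<lambda>q p. cell ys q (M $$ (p div b, p mod b))) l [0..<a * b])"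
  proof (rule spec_mapP)
    fix p ys assume "p \<in> set [0..<a * b]"
    then have p: "p < a * b" by simp
    then have "p div b < a" "p mod b < b"
      by (auto simp: less_mult_imp_div_less) (metis mod_less_divisor mult_0_right not_gr_zero not_less_zero)
    then show "spec (f (p div b) (p mod b)) (xs @ ys) t (\<lambda>l zs. cell zs l (M $$ (p div b, p mod b)))"
      by (rule assms(1))
  qed (use assms in \<open>auto intro: cell_append\<close>)
next
  fix l ys assume l: "list_all2 (\<lambda>q p. cell (xs @ ys) q (M $$ (p div b, p mod b))) l [0..<a * b]"
  have "cell (xs @ ys) (l ! (i * b + j)) (M $$ (i, j))" if "i < a" "j < b" for i j
    using list_all2_nthD2[OF l, of "i * b + j"] index_less[OF that] that by simp
  then show "spec (retP (mat a b (\<lambda>(i, j). l ! (i * b + j)))) (xs @ ys) 0 (\<lambda>P ys. holds ys P M)"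
    using assms(2) by (intro spec_retP) (auto simp: holds_def)
qed simp

definition subP :: "nat mat \<Rightarrow> nat mat \<Rightarrow> (nat mat, 'a) prog" where
  "subP P Q = matP (dim_row P) (dim_col P) (\<lambda>i j. arithP Minus (P $$ (i, j)) (Q $$ (i, j)))"

lemma over_subP [over]: "over K (subP P Q)"
  unfolding subP_def by (intro over)

lemma spec_subP:
  assumes "holds xs P M" "holds xs Q N" "M \<in> carrier_mat a b" "N \<in> carrier_mat a b" "a * b \<le> s"
  shows "spec (subP P Q) xs s (\<lambda>R ys. holds ys R (M - N :: 'a::field mat))"
  unfolding subP_def
proof (rule spec_matP[where t = 1])
  fix i j ys assume "i < dim_row P" "j < dim_col P"
  then have ij: "i < a" "j < b" using holds_dim[OF assms(1,3)] by auto
  then show "spec (arithP Minus (P $$ (i, j)) (Q $$ (i, j))) (xs @ ys) 1 (\<lambda>p zs. cell zs p ((M - N) $$ (i, j)))"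
    using assms by (intro spec_arithP[OF cell_append[OF holds_cell] cell_append[OF holds_cell]]) auto
qed (use holds_dim[OF assms(1,3)] assms minus_carrier_mat[OF assms(4), of M] in auto)

primrec findP :: "(nat \<Rightarrow> nat) \<Rightarrow> nat list \<Rightarrow> (nat option, 'a) prog" where
  "findP g [] = retP None"
| "findP g (i # js) = bindP (is_zeroP (g i)) (\<lambda>b. if b then findP g js else retP (Some i))"

lemma over_findP [over]: "over K (findP g js)"
  by (induction js) (auto intro!: over)

lemma spec_findP:
  assumes "\<And>i. i \<in> set js \<Longrightarrow> cell xs (g i) (v i)"
  shows "spec (findP g js) xs (length js)
    (\<lambda>r ys. case r of None \<Rightarrow> \<forall>i\<in>set js. v i = 0 | Some i \<Rightarrow> i \<in> set js \<and> v i \<noteq> (0 :: 'a::field))"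
  using assms
proof (induction js arbitrary: xs)
  case Nil
  then show ?case by (auto intro: spec_retP)
next
  case (Cons i js)
  have "cell xs (g i) (v i)" using Cons.prems by simp
  from spec_is_zeroP[OF this] show ?case unfolding findP.simps
  proof (rule spec_bindP[where t = "length js"])
    fix b ys assume b: "b \<longleftrightarrow> v i = 0"
    have "spec (findP g js) (xs @ ys) (length js)
      (\<lambda>r ys. case r of None \<Rightarrow> \<forall>i\<in>set js. v i = 0 | Some i \<Rightarrow> i \<in> set js \<and> v i \<noteq> 0)"
      using Cons.prems by (intro Cons.IH cell_append) auto
    then show "spec (if b then findP g js else retP (Some i)) (xs @ ys) (length js)
      (\<lambda>r ys. case r of None \<Rightarrow> \<forall>i\<in>set (i # js). v i = 0 | Some i' \<Rightarrow> i' \<in> set (i # js) \<and> v i' \<noteq> 0)"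
      using b by (cases b) (auto elim!: spec_mono intro!: spec_retP split: option.splits)
  qed simp
qed


section \<open>Products\<close>

text \<open>The trees \<open>MM e\<close> multiply square matrices only, so a rectangular factor
  gets a border of zeros. For a matrix of positions, \<open>z\<close> is the address of the constant
  0.\<close>

definition pad :: "nat \<Rightarrow> 'b \<Rightarrow> 'b mat \<Rightarrow> 'b mat" where
  "pad e z P = mat e e (\<lambda>(i, j). if i < dim_row P \<and> j < dim_col P then P $$ (i, j) else z)"

lemma pad_dim [simp]: "dim_row (pad e z P) = e" "dim_col (pad e z P) = e"
  by (simp_all add: pad_def)

lemma pad_mult:
  assumes "A \<in> carrier_mat a b" "B \<in> carrier_mat b d" "b \<le> e" "i < a" "a \<le> e" "j < d" "d \<le> e"
  shows "(pad e 0 A * pad e 0 B) $$ (i, j) = (A * B :: 'a::semiring_0 mat) $$ (i, j)"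
proof -
  have "(pad e 0 A * pad e 0 B) $$ (i, j) = (\<Sum>k\<in>{0..<e}. if k < b then A $$ (i, k) * B $$ (k, j) else 0)"
    using assms by (auto simp: pad_def scalar_prod_def intro!: sum.cong)
  also have "\<dots> = (\<Sum>k\<in>{0..<b}. A $$ (i, k) * B $$ (k, j))"
    using assms(3) by (intro sum.mono_neutral_cong_right) auto
  also have "\<dots> = (A * B) $$ (i, j)"
    using assms by (auto simp: scalar_prod_def intro!: sum.cong)
  finally show ?thesis .
qed

lemma holds_pad: "holds xs P M \<Longrightarrow> cell xs z 0 \<Longrightarrow> holds xs (pad e z P) (pad e 0 M)"
  by (auto simp: holds_def pad_def)

text \<open>\<open>\<mu>\<close> is the price of a column. A matrix with n rows consists of
  ceiling(n / e) strips of at most e rows; by the first condition on \<open>\<mu>\<close>,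
  multiplying all strips by one matrix of size at most e costs at most \<open>\<mu> * e\<close>. The
  second condition lets \<open>\<mu>\<close> also pay for linear work per column.\<close>

locale matmul_alg =
  fixes F :: "'a::field set" and MM :: "nat \<Rightarrow> (unit, 'a) ctree" and f :: "nat \<Rightarrow> nat" and n \<mu> :: nat
  assumes MM: "\<And>e. scalars (MM e) \<subseteq> F"
    "\<And>e A B. A \<in> carrier_mat e e \<Longrightarrow> B \<in> carrier_mat e e \<Longrightarrow>
       \<exists>k \<le> f e. run (MM e) (entries A @ entries B) = Some ((), entries (A * B), k)"
    and F: "0 \<in> F" "1 \<in> F"
    and \<mu>: "\<And>e. 1 \<le> e \<Longrightarrow> e \<le> n \<Longrightarrow> (n + e - 1) div e * f e \<le> \<mu> * e" "n \<le> \<mu>"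
begin

definition blockP :: "nat \<Rightarrow> nat \<Rightarrow> nat mat \<Rightarrow> nat mat \<Rightarrow> (nat mat, 'a) prog" where
  "blockP e z P Q = bindP (embedP (MM e) (entries (pad e z P) @ entries (pad e z Q)))
     (\<lambda>l. retP (mat (dim_row P) (dim_col Q) (\<lambda>(i, j). l ! (i * e + j))))"

lemma over_blockP [over]: "over F (blockP e z P Q)"
  unfolding blockP_def by (intro over MM(1))

lemma cells_appendI: "cells xs js vs \<Longrightarrow> cells xs js' vs' \<Longrightarrow> cells xs (js @ js') (vs @ vs')"
  by (simp add: cells_def list_all2_appendI)

lemma spec_blockP:
  assumes "holds xs P A" "holds xs Q B" "cell xs z 0"
    and "A \<in> carrier_mat a b" "B \<in> carrier_mat b d" "a \<le> e" "b \<le> e" "d \<le> e"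
  shows "spec (blockP e z P Q) xs (f e) (\<lambda>R ys. holds ys R (A * B))"
proof -
  obtain k where k: "k \<le> f e"
    "run (MM e) (entries (pad e 0 A) @ entries (pad e 0 B)) = Some ((), entries (pad e 0 A * pad e 0 B), k)"
    using MM(2)[of "pad e 0 A" e "pad e 0 B"] by (auto simp: pad_def)
  have "cells xs (entries (pad e z P) @ entries (pad e z Q)) (entries (pad e 0 A) @ entries (pad e 0 B))"
    using assms(1-3) by (intro cells_appendI holds_entries holds_pad)
  from spec_embedP[OF k(2) this] show ?thesis unfolding blockP_def
  proof (rule spec_bindP[where t = 0])
    fix l ys assume l: "cells (xs @ ys) l (entries (pad e 0 A * pad e 0 B))"
    have "cell (xs @ ys) (l ! (i * e + j)) ((A * B) $$ (i, j))" if "i < a" "j < d" for i j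
    proof -
      have "i < e" "j < e" using that assms(6-8) by auto
      then have "cell (xs @ ys) (l ! (i * e + j)) (entries (pad e 0 A * pad e 0 B) ! (i * e + j))"
        using l index_less[of i e j e] unfolding cells_conv_nth by simp
      also have "entries (pad e 0 A * pad e 0 B) ! (i * e + j) = (pad e 0 A * pad e 0 B) $$ (i, j)"
        using nth_entries[of i "pad e 0 A * pad e 0 B" j] \<open>i < e\<close> \<open>j < e\<close> by simp
      also have "\<dots> = (A * B) $$ (i, j)"
        using assms that by (intro pad_mult[OF assms(4,5)]) auto
      finally show ?thesis .
    qed
    then show "spec (retP (mat (dim_row P) (dim_col Q) (\<lambda>(i, j). l ! (i * e + j)))) (xs @ ys) 0
      (\<lambda>R ys. holds ys R (A * B))"
      using holds_dim[OF assms(1,4)] holds_dim[OF assms(2,5)] assms(4,5)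
      by (intro spec_retP) (auto simp: holds_def)
  qed (use k in simp)
qed

definition multP :: "nat \<Rightarrow> nat mat \<Rightarrow> nat mat \<Rightarrow> (nat mat, 'a) prog" where
  "multP e P Q = (if e = 0 then retP (mat (dim_row P) 0 (\<lambda>_. 0)) else
     bindP (constP 0) (\<lambda>z.
     bindP (mapP (\<lambda>q. blockP e z (sel [q * e..<min (q * e + e) (dim_row P)] P) Q) [0..<(dim_row P + e - 1) div e]) (\<lambda>l.
     retP (mat (dim_row P) (dim_col Q) (\<lambda>(i, j). l ! (i div e) $$ (i mod e, j))))))"

lemma over_multP [over]: "over F (multP e P Q)"
  unfolding multP_def by (intro over F)

text \<open>Only the number of rows of the first factor may exceed \<open>e\<close>, and the cost is
  proportional to \<open>e\<close>. So products of narrow matrices are cheap, which the halving in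
  \<open>basisP\<close> relies on.\<close>

lemma spec_multP:
  assumes P: "holds xs P A" and Q: "holds xs Q B"
    and A: "A \<in> carrier_mat a b" and B: "B \<in> carrier_mat b d" and le: "a \<le> n" "b \<le> e" "d \<le> e" "e \<le> n"
  shows "spec (multP e P Q) xs (\<mu> * e) (\<lambda>R ys. holds ys R (A * B))"
\<comment> \<open>For \<open>e = 0\<close> there is no division into strips, but the product has no
  columns either.\<close>
proof (cases "e = 0")
  case True
  then show ?thesis unfolding multP_def
    using holds_dim[OF P A] holds_dim[OF Q B] A B le by (auto intro!: spec_retP simp: holds_def)
next
  case False
  have dims: "dim_row P = a" "dim_col Q = d" using holds_dim[OF P A] holds_dim[OF Q B] by auto
  let ?I = "\<lambda>q. [q * e..<min (q * e + e) a]"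
  have "(a + e - 1) div e * f e \<le> (n + e - 1) div e * f e"
    using le(1) by (intro mult_right_mono div_le_mono) auto
  also have "\<dots> \<le> \<mu> * e" using \<mu>(1) False le(4) by simp
  finally have cost: "(a + e - 1) div e * f e \<le> \<mu> * e" .
  have "spec (bindP (constP 0) (\<lambda>z.
     bindP (mapP (\<lambda>q. blockP e z (sel (?I q) P) Q) [0..<(a + e - 1) div e]) (\<lambda>l.
     retP (mat a d (\<lambda>(i, j). l ! (i div e) $$ (i mod e, j)))))) xs (\<mu> * e) (\<lambda>R ys. holds ys R (A * B))"
  proof (rule spec_bindP[OF spec_constP, where t = "\<mu> * e"])
    fix z ys assume z: "cell (xs @ ys) z (0 :: 'a)"
    show "spec (bindP (mapP (\<lambda>q. blockP e z (sel (?I q) P) Q) [0..<(a + e - 1) div e]) (\<lambda>l.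
       retP (mat a d (\<lambda>(i, j). l ! (i div e) $$ (i mod e, j))))) (xs @ ys) (\<mu> * e) (\<lambda>R ys. holds ys R (A * B))"
    proof (rule spec_bindP[where t = 0])
      show "spec (mapP (\<lambda>q. blockP e z (sel (?I q) P) Q) [0..<(a + e - 1) div e]) (xs @ ys) (\<mu> * e)
        (\<lambda>l zs. list_all2 (\<lambda>R q. holds zs R (sel (?I q) A * B)) l [0..<(a + e - 1) div e])"
      proof (rule spec_mapP)
        fix q zs
        show "spec (blockP e z (sel (?I q) P) Q) ((xs @ ys) @ zs) (f e)
          (\<lambda>R zs. holds zs R (sel (?I q) A * B))"
        proof (rule spec_blockP)
          show "holds ((xs @ ys) @ zs) (sel (?I q) P) (sel (?I q) A)"
            using holds_append[OF holds_append[OF P]] A by (rule holds_sel) auto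
          show "sel (?I q) A \<in> carrier_mat (length (?I q)) b" using A by (rule sel_carrier)
          show "cell ((xs @ ys) @ zs) z 0" using z by (rule cell_append)
          show "B \<in> carrier_mat b d" by (rule B)
        qed (use Q le in \<open>auto intro!: holds_append2\<close>)
      qed (use cost in \<open>auto intro: holds_append\<close>)
    next
      fix l zs
      assume l: "list_all2 (\<lambda>R q. holds ((xs @ ys) @ zs) R (sel (?I q) A * B)) l [0..<(a + e - 1) div e]"
      have "cell ((xs @ ys) @ zs) (l ! (i div e) $$ (i mod e, j)) ((A * B) $$ (i, j))" if ij: "i < a" "j < d" for i j
      proof -
        have "i div e < (a + e - 1) div e"
        proof -
          have "(i + e) div e \<le> (a + e - 1) div e" using ij by (intro div_le_mono) simp
          then show ?thesis using False by simp
        qed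
        then have h: "holds ((xs @ ys) @ zs) (l ! (i div e)) (sel (?I (i div e)) A * B)"
          using list_all2_nthD2[OF l, of "i div e"] by simp
        have len: "i mod e < length (?I (i div e))" "?I (i div e) ! (i mod e) = i"
        proof -
          have "i div e * e + i mod e = i" by simp
          moreover have "i mod e < e" using False by simp
          ultimately have *: "i div e * e + i mod e < min (i div e * e + e) a" using ij by linarith
          then show "i mod e < length (?I (i div e))" by (simp only: length_upt less_diff_conv add.commute)
          show "?I (i div e) ! (i mod e) = i" using nth_upt[OF *] by simp
        qed
        have AB: "sel (?I (i div e)) A * B \<in> carrier_mat (length (?I (i div e))) d"
          using A B by (intro mult_carrier_mat) auto
        have "cell ((xs @ ys) @ zs) (l ! (i div e) $$ (i mod e, j)) ((sel (?I (i div e)) A * B) $$ (i mod e, j))"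
          using holds_cell[OF h AB len(1)] ij by simp
        also have "sel (?I (i div e)) A * B = sel (?I (i div e)) (A * B)"
          using A B by (intro sel_mult[symmetric]) auto
        also have "\<dots> $$ (i mod e, j) = (A * B) $$ (i, j)"
          using len ij A B by simp
        finally show ?thesis .
      qed
      then show "spec (retP (mat a d (\<lambda>(i, j). l ! (i div e) $$ (i mod e, j)))) ((xs @ ys) @ zs) 0
        (\<lambda>R ys. holds ys R (A * B))"
        using A B by (intro spec_retP) (auto simp: holds_def)
    qed simp
  qed simp
  then show ?thesis using False unfolding multP_def dims by simp
qed

end


section \<open>Elimination\<close>

context matmul_alg
begin

definition singleP :: "nat mat \<Rightarrow> (nat list \<times> nat mat, 'a) prog" where
  "singleP P = bindP (findP (\<lambda>i. P $$ (i, 0)) [0..<n]) (\<lambda>r. case r of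
     None \<Rightarrow> retP ([], mat n 0 (\<lambda>_. 0))
   | Some p \<Rightarrow> bindP (matP n 1 (\<lambda>i j. arithP Divide (P $$ (i, 0)) (P $$ (p, 0)))) (\<lambda>G. retP ([p], G)))"

lemma over_singleP [over]: "over F (singleP P)"
  unfolding singleP_def by (intro over)

text \<open>Thanks to the bound on \<open>length I\<close>, the number of columns alone determines a
  sufficient \<open>e\<close> for the products in \<open>extendP\<close>.\<close>

definition basis_of :: "'a mat \<Rightarrow> nat list \<times> nat mat \<Rightarrow> 'a list \<Rightarrow> bool" where
  "basis_of C = (\<lambda>(I, P) ys. \<exists>G. holds ys P G \<and> red_basis n I G \<and> cs G = cs C \<and> length I \<le> dim_col C)"

lemma basis_of_empty: "C \<in> carrier_mat n c \<Longrightarrow> cs C = {0\<^sub>v n} \<Longrightarrow> basis_of C ([], mat n 0 (\<lambda>_. 0)) ys"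
  unfolding basis_of_def using red_basis_empty[of n "\<lambda>_. 0 :: 'a"]
  by (auto simp: holds_def intro!: exI[of _ "mat n 0 (\<lambda>_. 0)"])

lemma spec_singleP:
  assumes P: "holds xs P C" and C: "C \<in> carrier_mat n 1"
  shows "spec (singleP P) xs (2 * n) (basis_of C)"
  unfolding singleP_def
proof (rule spec_bindP[where t = n])
  show "spec (findP (\<lambda>i. P $$ (i, 0)) [0..<n]) xs n (\<lambda>r ys. case r of
      None \<Rightarrow> \<forall>i\<in>set [0..<n]. C $$ (i, 0) = 0 | Some i \<Rightarrow> i \<in> set [0..<n] \<and> C $$ (i, 0) \<noteq> 0)"
    using spec_findP[of "[0..<n]" xs "\<lambda>i. P $$ (i, 0)" "\<lambda>i. C $$ (i, 0)"] holds_cell[OF P C] by simp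
next
  fix r ys
  assume r: "case r of None \<Rightarrow> \<forall>i\<in>set [0..<n]. C $$ (i, 0) = 0 | Some i \<Rightarrow> i \<in> set [0..<n] \<and> C $$ (i, 0) \<noteq> 0"
  show "spec (case r of None \<Rightarrow> retP ([], mat n 0 (\<lambda>_. 0))
    | Some p \<Rightarrow> bindP (matP n 1 (\<lambda>i j. arithP Divide (P $$ (i, 0)) (P $$ (p, 0)))) (\<lambda>G. retP ([p], G)))
    (xs @ ys) n (basis_of C)"
  proof (cases r)
    case None
    then have "cs C = {0\<^sub>v n}" using r C by (intro cs_eq_zero) auto
    then show ?thesis using None by (auto intro!: spec_retP basis_of_empty[OF C])
  next
    case (Some p)
    then have p: "p < n" "C $$ (p, 0) \<noteq> 0" using r by auto
    let ?G = "mat n 1 (\<lambda>(i, j). C $$ (i, 0) / C $$ (p, 0))"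
    have "spec (matP n 1 (\<lambda>i j. arithP Divide (P $$ (i, 0)) (P $$ (p, 0)))) (xs @ ys) n (\<lambda>P ys. holds ys P ?G)"
    proof (rule spec_matP[where t = 1])
      fix i j zs assume "i < n" "j < (1::nat)"
      then show "spec (arithP Divide (P $$ (i, 0)) (P $$ (p, 0))) ((xs @ ys) @ zs) 1 (\<lambda>q zs. cell zs q (?G $$ (i, j)))"
        using holds_cell[OF holds_append2[OF P] C] p by (intro spec_arithP) auto
    qed auto
    then have "spec (bindP (matP n 1 (\<lambda>i j. arithP Divide (P $$ (i, 0)) (P $$ (p, 0)))) (\<lambda>G. retP ([p], G)))
      (xs @ ys) n (basis_of C)"
    proof (rule spec_bindP[where t = 0])
      fix Q zs assume "holds ((xs @ ys) @ zs) Q ?G"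
      then show "spec (retP ([p], Q)) ((xs @ ys) @ zs) 0 (basis_of C)"
        using cs_single[OF C p] C by (intro spec_retP) (auto simp: basis_of_def)
    qed simp
    then show ?thesis using Some by simp
  qed
qed simp

text \<open>The elimination \<open>b\<close> is a parameter because \<open>basisP\<close> passes its
  own recursive call. The third result singles out the new columns, which complement the old
  space.\<close>

definition extendP ::
  "nat \<Rightarrow> (nat mat \<Rightarrow> (nat list \<times> nat mat, 'a) prog) \<Rightarrow> nat list \<Rightarrow> nat mat \<Rightarrow> nat mat \<Rightarrow>
   (nat list \<times> nat mat \<times> nat mat, 'a) prog" where
  "extendP e b I G C =
     bindP (multP e G (sel I C)) (\<lambda>X. bindP (subP C X) (\<lambda>C'. bindP (b C') (\<lambda>(I\<^sub>2, G\<^sub>2).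
     bindP (multP e G\<^sub>2 (sel I\<^sub>2 G)) (\<lambda>Y. bindP (subP G Y) (\<lambda>G'. retP (I @ I\<^sub>2, hcat G' G\<^sub>2, G\<^sub>2))))))"

lemma over_extendP [over]: "(\<And>P. over F (b P)) \<Longrightarrow> over F (extendP e b I G C)"
  unfolding extendP_def by (intro over)

text \<open>\<open>U\<close> has exactly as many columns as there are new pivots. This makes the
  potential in \<open>spec_krylovP\<close> telescope.\<close>

definition extension_of :: "nat list \<Rightarrow> 'a mat \<Rightarrow> 'a mat \<Rightarrow> nat list \<times> nat mat \<times> nat mat \<Rightarrow> 'a list \<Rightarrow> bool" where
  "extension_of I G C = (\<lambda>(I', P, Q) ys. \<exists>G' U. holds ys P G' \<and> holds ys Q U \<and> red_basis n I' G' \<and>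
     cs G' = cs G \<boxplus> cs C \<and> cs G' = cs G \<boxplus> cs U \<and> U \<in> carrier_mat n (length I' - length I) \<and>
     length I \<le> length I' \<and> length I' \<le> length I + dim_col C)"

text \<open>Correctness is \<open>red_basis_extend\<close>. The 4 counts two products and two
  subtractions; a subtraction concerns at most \<open>n * e\<close> entries and is paid for by n
  \<le> \<mu>.\<close>

lemma spec_extendP:
  assumes P: "holds xs P G" and Q: "holds xs Q C" and G: "red_basis n I G" and C: "C \<in> carrier_mat n c"
    and le: "length I \<le> e" "c \<le> e" "e \<le> n"
    and b: "\<And>ys R D. holds (xs @ ys) R D \<Longrightarrow> D \<in> carrier_mat n c \<Longrightarrow> spec (b R) (xs @ ys) t (basis_of D)"
  shows "spec (extendP e b I P Q) xs (t + 4 * (\<mu> * e)) (extension_of I G C)"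
proof -
  have Gc: "G \<in> carrier_mat n (length I)" and I: "set I \<subseteq> {..<n}" using G by (auto simp: red_basis_def)
  have GC: "G * sel I C \<in> carrier_mat n c" using mult_carrier_mat[OF Gc sel_carrier[OF C]] .
  let ?C' = "C - G * sel I C"
  have C': "?C' \<in> carrier_mat n c" using GC by (rule minus_carrier_mat)
  have sub_cost: "n * k \<le> \<mu> * e" if "k \<le> e" for k using \<mu>(2) that by (rule mult_le_mono)
  have 1: "spec (multP e P (sel I Q)) xs (\<mu> * e) (\<lambda>X ys. holds ys X (G * sel I C))"
    using le by (intro spec_multP[OF P holds_sel[OF Q C I] Gc sel_carrier[OF C]]) auto
  show ?thesis unfolding extendP_def
  proof (rule spec_bindP[OF 1, where t = "t + 3 * (\<mu> * e)"])
    fix X ys assume X: "holds (xs @ ys) X (G * sel I C)"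
    have 2: "spec (subP Q X) (xs @ ys) (\<mu> * e) (\<lambda>R ys. holds ys R ?C')"
      using holds_append[OF Q] X C GC by (rule spec_subP) (rule sub_cost[OF le(2)])
    show "spec (bindP (subP Q X) (\<lambda>C'. bindP (b C') (\<lambda>(I\<^sub>2, G\<^sub>2).
     bindP (multP e G\<^sub>2 (sel I\<^sub>2 P)) (\<lambda>Y. bindP (subP P Y) (\<lambda>G'. retP (I @ I\<^sub>2, hcat G' G\<^sub>2, G\<^sub>2))))))
     (xs @ ys) (t + 3 * (\<mu> * e)) (extension_of I G C)"
    proof (rule spec_bindP[OF 2, where t = "t + 2 * (\<mu> * e)"])
      fix R zs assume "holds ((xs @ ys) @ zs) R ?C'"
      then have 3: "spec (b R) ((xs @ ys) @ zs) t (basis_of ?C')"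
        using b[of "ys @ zs" R ?C'] C' by simp
      show "spec (bindP (b R) (\<lambda>(I\<^sub>2, G\<^sub>2).
        bindP (multP e G\<^sub>2 (sel I\<^sub>2 P)) (\<lambda>Y. bindP (subP P Y) (\<lambda>G'. retP (I @ I\<^sub>2, hcat G' G\<^sub>2, G\<^sub>2)))))
        ((xs @ ys) @ zs) (t + 2 * (\<mu> * e)) (extension_of I G C)"
      proof (rule spec_bindP[OF 3, where t = "2 * (\<mu> * e)"])
        fix IG us assume IG: "basis_of ?C' IG (((xs @ ys) @ zs) @ us)"
        obtain I\<^sub>2 P\<^sub>2 where [simp]: "IG = (I\<^sub>2, P\<^sub>2)" by (cases IG)
        let ?xs = "((xs @ ys) @ zs) @ us"
        obtain G\<^sub>2 where G2: "holds ?xs P\<^sub>2 G\<^sub>2" "red_basis n I\<^sub>2 G\<^sub>2" "cs G\<^sub>2 = cs ?C'" "length I\<^sub>2 \<le> c"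
          using IG C' by (auto simp: basis_of_def)
        have G2c: "G\<^sub>2 \<in> carrier_mat n (length I\<^sub>2)" and I2: "set I\<^sub>2 \<subseteq> {..<n}"
          using G2(2) by (auto simp: red_basis_def)
        have Pxs: "holds ?xs P G" using holds_append[OF P, of "ys @ zs @ us"] by simp
        have GG: "G\<^sub>2 * sel I\<^sub>2 G \<in> carrier_mat n (length I)" using mult_carrier_mat[OF G2c sel_carrier[OF Gc]] .
        have 4: "spec (multP e P\<^sub>2 (sel I\<^sub>2 P)) ?xs (\<mu> * e) (\<lambda>Y ys. holds ys Y (G\<^sub>2 * sel I\<^sub>2 G))"
          using le G2(4) by (intro spec_multP[OF G2(1) holds_sel[OF Pxs Gc I2] G2c sel_carrier[OF Gc]]) auto
        have "spec (bindP (multP e P\<^sub>2 (sel I\<^sub>2 P)) (\<lambda>Y. bindP (subP P Y) (\<lambda>G'. retP (I @ I\<^sub>2, hcat G' P\<^sub>2, P\<^sub>2))))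
          ?xs (2 * (\<mu> * e)) (extension_of I G C)"
        proof (rule spec_bindP[OF 4, where t = "\<mu> * e"])
          fix Y vs assume Y: "holds (?xs @ vs) Y (G\<^sub>2 * sel I\<^sub>2 G)"
          have 5: "spec (subP P Y) (?xs @ vs) (\<mu> * e) (\<lambda>R ys. holds ys R (G - G\<^sub>2 * sel I\<^sub>2 G))"
            using holds_append[OF Pxs] Y Gc GG by (rule spec_subP) (rule sub_cost[OF le(1)])
          show "spec (bindP (subP P Y) (\<lambda>G'. retP (I @ I\<^sub>2, hcat G' P\<^sub>2, P\<^sub>2))) (?xs @ vs) (\<mu> * e) (extension_of I G C)"
          proof (rule spec_bindP[OF 5, where t = 0])
            fix P' ws assume P': "holds ((?xs @ vs) @ ws) P' (G - G\<^sub>2 * sel I\<^sub>2 G)"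
            note ext = red_basis_extend[OF G C G2(2,3)]
            have "holds ((?xs @ vs) @ ws) P\<^sub>2 G\<^sub>2"
              using holds_append2[OF G2(1)] by simp
            moreover from this P' have "holds ((?xs @ vs) @ ws) (hcat P' P\<^sub>2) (hcat (G - G\<^sub>2 * sel I\<^sub>2 G) G\<^sub>2)"
              using G2c GG by (intro holds_hcat) auto
            moreover have "length I\<^sub>2 \<le> dim_col C" using G2(4) C by simp
            ultimately show "spec (retP (I @ I\<^sub>2, hcat P' P\<^sub>2, P\<^sub>2)) ((?xs @ vs) @ ws) 0 (extension_of I G C)"
              unfolding extension_of_def using ext G2c
              by (intro spec_retP, unfold prod.case, intro exI[of _ "hcat (G - G\<^sub>2 * sel I\<^sub>2 G) G\<^sub>2"] exI[of _ "G\<^sub>2"]) simp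
          qed simp
        qed simp
        then show "spec (case IG of (I\<^sub>2, G\<^sub>2) \<Rightarrow>
          bindP (multP e G\<^sub>2 (sel I\<^sub>2 P)) (\<lambda>Y. bindP (subP P Y) (\<lambda>G'. retP (I @ I\<^sub>2, hcat G' G\<^sub>2, G\<^sub>2))))
          ?xs (2 * (\<mu> * e)) (extension_of I G C)" by simp
      qed simp
    qed simp
  qed simp
qed

primrec basisP :: "nat \<Rightarrow> nat mat \<Rightarrow> (nat list \<times> nat mat, 'a) prog" where
  "basisP 0 P = (if dim_col P = 0 then retP ([], mat n 0 (\<lambda>_. 0)) else singleP P)"
| "basisP (Suc d) P = (if dim_col P = 0 then retP ([], mat n 0 (\<lambda>_. 0)) else
     bindP (basisP d (slice 0 (dim_col P div 2) P)) (\<lambda>(I, G).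
     bindP (extendP (dim_col P - dim_col P div 2) (basisP d) I G (slice (dim_col P div 2) (dim_col P) P)) (\<lambda>(I', G', U).
     retP (I', G'))))"

lemma over_basisP [over]: "over F (basisP d P)"
proof (induction d arbitrary: P)
  case 0
  then show ?case unfolding basisP.simps by (intro over)
next
  case (Suc d)
  then show ?case unfolding basisP.simps by (intro over)
qed

text \<open>A single column takes at most n tests and n divisions, hence the 2. Each of the
  \<open>d\<close> levels of halving adds at most \<open>4 * \<mu>\<close> per column, the overhead
  of \<open>spec_extendP\<close> with the larger half as \<open>e\<close>.\<close>

lemma spec_basisP:
  "holds xs P C \<Longrightarrow> C \<in> carrier_mat n c \<Longrightarrow> c \<le> n \<Longrightarrow> c \<le> 2 ^ d \<Longrightarrow>
   spec (basisP d P) xs (\<mu> * c * (4 * d + 2)) (basis_of C)"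
proof (induction d arbitrary: xs P C c)
  case 0
  have dim: "dim_col P = c" using holds_dim[OF 0(1,2)] by simp
  show ?case
  proof (cases "c = 0")
    case True
    then have "cs C = {0\<^sub>v n}" using 0(2) by (intro cs_eq_zero) auto
    then show ?thesis using True dim by (auto intro!: spec_retP basis_of_empty[OF 0(2)])
  next
    case False
    then have "c = 1" using 0 by simp
    then have "spec (singleP P) xs (2 * n) (basis_of C)" using 0 by (intro spec_singleP) auto
    then have "spec (singleP P) xs (\<mu> * c * (4 * 0 + 2)) (basis_of C)"
      by (rule spec_mono) (use \<mu>(2) \<open>c = 1\<close> in auto)
    then show ?thesis using False dim by simp
  qed
next
  case (Suc d)
  have dim: "dim_col P = c" using holds_dim[OF Suc(2,3)] by simp
  show ?case
  proof (cases "c = 0")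
    case True
    then have "cs C = {0\<^sub>v n}" using Suc(3) by (intro cs_eq_zero) auto
    then show ?thesis using True dim by (auto intro!: spec_retP basis_of_empty[OF Suc(3)])
  next
    case False
    let ?h = "c div 2"
    have C1: "slice 0 ?h C \<in> carrier_mat n ?h" and C2: "slice ?h c C \<in> carrier_mat n (c - ?h)"
      using slice_carrier[OF Suc(3), of 0 ?h] slice_carrier[OF Suc(3), of ?h c] by auto
    have P1: "holds xs (slice 0 ?h P) (slice 0 ?h C)" and P2: "holds xs (slice ?h c P) (slice ?h c C)"
      using holds_slice[OF Suc(2)] Suc(3) by auto
    have C12: "cs C = cs (slice 0 ?h C) \<boxplus> cs (slice ?h c C)"
      using cs_hcat[OF C1 C2] hcat_slice[OF Suc(3), of ?h] by simp
    have 1: "spec (basisP d (slice 0 ?h P)) xs (\<mu> * ?h * (4 * d + 2)) (basis_of (slice 0 ?h C))"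
      using Suc(4,5) by (intro Suc.IH[OF P1 C1]) auto
    have "spec (bindP (basisP d (slice 0 ?h P)) (\<lambda>(I, G).
      bindP (extendP (c - ?h) (basisP d) I G (slice ?h c P)) (\<lambda>(I', G', U). retP (I', G'))))
      xs (\<mu> * c * (4 * Suc d + 2)) (basis_of C)"
    proof (rule spec_bindP[OF 1, where t = "\<mu> * (c - ?h) * (4 * d + 2) + 4 * (\<mu> * (c - ?h))"])
      fix IG ys assume IG: "basis_of (slice 0 ?h C) IG (xs @ ys)"
      obtain I R where [simp]: "IG = (I, R)" by (cases IG)
      obtain G where G: "holds (xs @ ys) R G" "red_basis n I G" "cs G = cs (slice 0 ?h C)" "length I \<le> ?h"
        using IG C1 by (auto simp: basis_of_def)
      have 2: "spec (extendP (c - ?h) (basisP d) I R (slice ?h c P)) (xs @ ys)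
        (\<mu> * (c - ?h) * (4 * d + 2) + 4 * (\<mu> * (c - ?h))) (extension_of I G (slice ?h c C))"
        using Suc(4,5) G(4)
        by (intro spec_extendP[OF G(1) holds_append[OF P2] G(2) C2] Suc.IH) auto
      have "spec (bindP (extendP (c - ?h) (basisP d) I R (slice ?h c P)) (\<lambda>(I', G', U). retP (I', G'))) (xs @ ys)
        (\<mu> * (c - ?h) * (4 * d + 2) + 4 * (\<mu> * (c - ?h))) (basis_of C)"
      proof (rule spec_bindP[OF 2, where t = 0])
        fix r zs assume r: "extension_of I G (slice ?h c C) r ((xs @ ys) @ zs)"
        obtain I' R' U where [simp]: "r = (I', R', U)" by (cases r)
        obtain G' where "holds ((xs @ ys) @ zs) R' G'" "red_basis n I' G'" "cs G' = cs G \<boxplus> cs (slice ?h c C)"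
          "length I' \<le> length I + (c - ?h)"
          using r C2 by (auto simp: extension_of_def)
        then show "spec (case r of (I', G', U) \<Rightarrow> retP (I', G')) ((xs @ ys) @ zs) 0 (basis_of C)"
          using C12 G(3,4) Suc(3) by (auto intro!: spec_retP simp: basis_of_def)
      qed simp
      then show "spec (case IG of (I, G) \<Rightarrow>
        bindP (extendP (c - ?h) (basisP d) I G (slice ?h c P)) (\<lambda>(I', G', U). retP (I', G'))) (xs @ ys)
        (\<mu> * (c - ?h) * (4 * d + 2) + 4 * (\<mu> * (c - ?h))) (basis_of C)" by simp
    next
      have "\<mu> * ?h * (4 * d + 2) + \<mu> * (c - ?h) * (4 * d + 2) = \<mu> * (?h + (c - ?h)) * (4 * d + 2)"
        by (simp only: distrib_left distrib_right)
      then have "\<mu> * ?h * (4 * d + 2) + (\<mu> * (c - ?h) * (4 * d + 2) + 4 * (\<mu> * (c - ?h)))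
        = \<mu> * c * (4 * d + 2) + 4 * (\<mu> * (c - ?h))"
        by simp
      also have "\<dots> \<le> \<mu> * c * (4 * d + 2) + 4 * (\<mu> * c)" by simp
      finally show "\<mu> * ?h * (4 * d + 2) + (\<mu> * (c - ?h) * (4 * d + 2) + 4 * (\<mu> * (c - ?h)))
        \<le> \<mu> * c * (4 * Suc d + 2)" by (simp add: algebra_simps)
    qed
    then show ?thesis using False dim by simp
  qed
qed

end


section \<open>The Krylov iteration\<close>

lemma hcat_slices: "A \<in> carrier_mat n c \<Longrightarrow> a \<le> b \<Longrightarrow> b \<le> c \<Longrightarrow> hcat (slice 0 a A) (slice a b A) = slice 0 b A"
  by (intro eq_matI) (auto simp: hcat_def slice_def)

text \<open>One \<open>d\<close> for two purposes: the depth of the halving in \<open>basisP\<close>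
  and the number of doublings of \<open>h\<close> in \<open>krylovP\<close>.\<close>

locale kalman_alg = matmul_alg +
  fixes d :: nat
  assumes d: "n \<le> 2 ^ d"
begin

text \<open>There may be more than \<open>n\<close> columns, but \<open>spec_basisP\<close> bounds the cost for at most \<open>n\<close> of them only.\<close>

primrec colbasisP :: "nat \<Rightarrow> nat mat \<Rightarrow> (nat list \<times> nat mat, 'a) prog" where
  "colbasisP 0 P = retP ([], mat n 0 (\<lambda>_. 0))"
| "colbasisP (Suc q) P = bindP (colbasisP q P) (\<lambda>(I, G).
     bindP (extendP n (basisP d) I G (slice (min (dim_col P) (q * n)) (min (dim_col P) (q * n + n)) P)) (\<lambda>(I', G', U).
     retP (I', G')))"

lemma over_colbasisP [over]: "over F (colbasisP q P)"
proof (induction q)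
  case 0
  then show ?case unfolding colbasisP.simps by (intro over)
next
  case (Suc q)
  then show ?case unfolding colbasisP.simps by (intro over)
qed

lemma spec_extendP_basisP:
  assumes "holds xs P G" "holds xs Q C" "red_basis n I G" "C \<in> carrier_mat n c" "c \<le> n"
  shows "spec (extendP n (basisP d) I P Q) xs (\<mu> * c * (4 * d + 2) + 4 * (\<mu> * n)) (extension_of I G C)"
  using red_basis_length[OF assms(3)] assms(5) d
  by (intro spec_extendP[OF assms(1-4)] spec_basisP) auto

text \<open>Slices beyond the last column are empty, so the number of rounds need not depend on
  \<open>m\<close>: \<open>c\<close> rounds serve all m \<le> c * n. In each round,
  \<open>4 * d + 6\<close> is \<open>4 * d + 2\<close> for eliminating up to n columns, plus 4 for
  the reductions.\<close>

lemma spec_colbasisP: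
  assumes P: "holds xs P C" and C: "C \<in> carrier_mat n m"
  shows "spec (colbasisP q P) xs (q * (\<mu> * n * (4 * d + 6)))
    (\<lambda>(I, R) ys. \<exists>G. holds ys R G \<and> red_basis n I G \<and> cs G = cs (slice 0 (min m (q * n)) C))"
proof (induction q)
  case 0
  have "cs (slice 0 0 C) = {0\<^sub>v n}" using slice_carrier[OF C, of 0 0] by (intro cs_eq_zero) auto
  then show ?case
    using red_basis_empty[of n "\<lambda>_. 0 :: 'a"]
    by (auto intro!: spec_retP exI[of _ "mat n 0 (\<lambda>_. 0)"] simp: holds_def)
next
  case (Suc q)
  have dim: "dim_col P = m" using holds_dim[OF P C] by simp
  let ?a = "min m (q * n)" and ?b = "min m (q * n + n)"
  have D: "slice ?a ?b C \<in> carrier_mat n (?b - ?a)" using C by (rule slice_carrier)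
  have PD: "holds xs (slice ?a ?b P) (slice ?a ?b C)" using C by (intro holds_slice[OF P]) auto
  show ?case unfolding colbasisP.simps dim
  proof (rule spec_bindP[OF Suc, where t = "\<mu> * n * (4 * d + 6)"], goal_cases)
    case (1 IG ys)
    obtain I R where [simp]: "IG = (I, R)" by (cases IG)
    obtain G where G: "holds (xs @ ys) R G" "red_basis n I G" "cs G = cs (slice 0 ?a C)"
      using 1 by auto
    have "spec (extendP n (basisP d) I R (slice ?a ?b P)) (xs @ ys)
      (\<mu> * (?b - ?a) * (4 * d + 2) + 4 * (\<mu> * n)) (extension_of I G (slice ?a ?b C))"
      by (intro spec_extendP_basisP[OF G(1) holds_append[OF PD] G(2) D]) auto
    then have "spec (extendP n (basisP d) I R (slice ?a ?b P)) (xs @ ys)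
      (\<mu> * n * (4 * d + 6)) (extension_of I G (slice ?a ?b C))"
    proof (rule spec_mono)
      have "\<mu> * (?b - ?a) * (4 * d + 2) \<le> \<mu> * n * (4 * d + 2)"
        by (intro mult_le_mono) auto
      then show "\<mu> * (?b - ?a) * (4 * d + 2) + 4 * (\<mu> * n) \<le> \<mu> * n * (4 * d + 6)"
        by (simp add: algebra_simps)
    qed
    then show ?case unfolding \<open>IG = (I, R)\<close> prod.case
    proof (rule spec_bindP[where t = 0], goal_cases)
      case (1 r zs)
      obtain I' R' U where [simp]: "r = (I', R', U)" by (cases r)
      obtain G' where "holds ((xs @ ys) @ zs) R' G'" "red_basis n I' G'" "cs G' = cs G \<boxplus> cs (slice ?a ?b C)"
        using 1 by (auto simp: extension_of_def)
      moreover have "cs (slice 0 ?a C) \<boxplus> cs (slice ?a ?b C) = cs (slice 0 ?b C)"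
        using cs_hcat[OF slice_carrier[OF C, of 0 ?a] D] hcat_slices[OF C, of ?a ?b] by simp
      ultimately show ?case using G(3)
        by (auto intro!: spec_retP exI[of _ G'] simp: add.commute)
    qed simp
  qed (simp add: algebra_simps)
qed

text \<open>As \<open>h\<close> doubles, the next \<open>W\<close> must complement
  \<open>kry A B k\<close> in \<open>kry A B (k + 2 * h)\<close>. This is why a step makes two
  extensions; one alone reaches only the index \<open>k + h\<close>.\<close>

primrec krylovP :: "nat \<Rightarrow> nat list \<Rightarrow> nat mat \<Rightarrow> nat mat \<Rightarrow> nat mat \<Rightarrow> (nat list \<times> nat mat, 'a) prog" where
  "krylovP 0 I G W P = retP (I, G)"
| "krylovP (Suc q) I G W P =
     bindP (multP n P W) (\<lambda>X. bindP (extendP n (basisP d) I G X) (\<lambda>(I\<^sub>1, G\<^sub>1, U).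
     bindP (multP n P X) (\<lambda>Y. bindP (extendP n (basisP d) I\<^sub>1 G\<^sub>1 Y) (\<lambda>(I\<^sub>2, G\<^sub>2, V).
     bindP (multP n P P) (\<lambda>P'. krylovP q I\<^sub>2 G\<^sub>2 (hcat U V) P')))))"

lemma over_krylovP [over]: "over F (krylovP q I G W P)"
proof (induction q arbitrary: I G W P)
  case 0
  then show ?case unfolding krylovP.simps by (intro over)
next
  case (Suc q)
  then show ?case unfolding krylovP.simps by (intro over)
qed

text \<open>The summand \<open>n - length I + w\<close> of the cost bound is a potential: one step eliminates \<open>2 * w\<close>
  columns, and the next \<open>w\<close> is the increase of \<open>length I\<close>. Thus \<open>O(n)\<close> columns are
  eliminated altogether, although there may be \<open>d\<close> steps with up to \<open>n\<close> columns each.\<close>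

lemma spec_krylovP:
  assumes kry: "krylov A B n m"
  shows "holds xs R G \<Longrightarrow> holds xs S W \<Longrightarrow> holds xs P (A ^\<^sub>m h) \<Longrightarrow> red_basis n I G \<Longrightarrow> cs G = kry A B k \<Longrightarrow>
    W \<in> carrier_mat n w \<Longrightarrow> w \<le> n \<Longrightarrow> h \<le> k \<Longrightarrow> kry A B k = kry A B (k - h) \<boxplus> cs W \<Longrightarrow>
    spec (krylovP q I R S P) xs (q * (11 * (\<mu> * n)) + 2 * \<mu> * (4 * d + 2) * (n - length I + w))
      (\<lambda>(I', R') ys. \<exists>G'. holds ys R' G' \<and> red_basis n I' G' \<and> cs G' = kry A B (k + 2 * h * (2 ^ q - 1)))"
proof (induction q arbitrary: xs I R S P G W h k w)
  case 0
  then show ?case by (auto intro!: spec_retP)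
next
  case (Suc q)
  interpret krylov A B n m by (rule kry)
  note R = Suc.prems(1) and S = Suc.prems(2) and P = Suc.prems(3) and G = Suc.prems(4,5)
    and W = Suc.prems(6,7) and hk = Suc.prems(8,9)
  let ?M = "\<mu> * n" and ?D = "4 * d + 2"
  let ?rest = "\<lambda>I. q * (11 * ?M) + 2 * \<mu> * ?D * (n - length I)"
  let ?Q = "\<lambda>(I', R') ys. \<exists>G'. holds ys R' G' \<and> red_basis n I' G' \<and> cs G' = K (k + 2 * h * (2 ^ Suc q - 1))"
  let ?X = "A ^\<^sub>m h * W" and ?Y = "A ^\<^sub>m h * (A ^\<^sub>m h * W)"
  have X: "?X \<in> carrier_mat n w" using mult_carrier_mat[OF pow_carrier W(1)] .
  have Y: "?Y \<in> carrier_mat n w" using mult_carrier_mat[OF pow_carrier X] .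
  have kX: "K (k + h) = K k \<boxplus> cs ?X" using kry_step[OF hk(1) W(1) hk(2)] .
  \<comment> \<open>The first extension supplies the premise of \<open>kry_step\<close> for
    \<open>k + h\<close>, with \<open>?X\<close> in the place of \<open>W\<close>.\<close>
  have kY: "K (k + h + h) = K (k + h) \<boxplus> cs ?Y" using kry_step[of h "k + h", OF _ X] kX by simp
  have ext_cost: "\<mu> * w * ?D + 4 * ?M \<le> 5 * ?M + \<mu> * w * ?D" by simp
  have 1: "spec (multP n P S) xs ?M (\<lambda>X ys. holds ys X ?X)"
    using W(2) by (intro spec_multP[OF P S pow_carrier W(1)]) auto
  show ?case unfolding krylovP.simps
  \<comment> \<open>The 11 consists of three products and of 4 for each of two extensions; the first
    product is paid here. The summand with \<open>w\<close> pays for the elimination of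
    \<open>2 * w\<close> columns, \<open>?rest I\<close> for the recursive call.\<close>
  proof (rule spec_bindP[OF 1, where t = "10 * ?M + 2 * \<mu> * ?D * w + ?rest I"], goal_cases)
    case (1 XP xs1)
    let ?xs1 = "xs @ xs1"
    have E1: "spec (extendP n (basisP d) I R XP) ?xs1 (\<mu> * w * ?D + 4 * ?M) (extension_of I G ?X)"
      using spec_extendP_basisP[OF holds_append[OF R] 1 G(1) X W(2)] .
    show ?case
    proof (rule spec_bindP[OF E1, where t = "6 * ?M + \<mu> * w * ?D + ?rest I"], goal_cases)
      case E: (1 r xs2)
      let ?xs2 = "?xs1 @ xs2"
      obtain I\<^sub>1 R\<^sub>1 UP where r [simp]: "r = (I\<^sub>1, R\<^sub>1, UP)" by (cases r)
      obtain G\<^sub>1 U where G1: "holds ?xs2 R\<^sub>1 G\<^sub>1" "holds ?xs2 UP U" "red_basis n I\<^sub>1 G\<^sub>1"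
        "cs G\<^sub>1 = cs G \<boxplus> cs ?X" "cs G\<^sub>1 = cs G \<boxplus> cs U" "U \<in> carrier_mat n (length I\<^sub>1 - length I)"
        "length I \<le> length I\<^sub>1"
        using E by (auto simp: extension_of_def)
      have XP: "holds ?xs2 XP ?X" using 1 by (rule holds_append)
      have P2: "holds ?xs2 P (A ^\<^sub>m h)" using holds_append2[OF P] by simp
      have M2: "spec (multP n P XP) ?xs2 ?M (\<lambda>X ys. holds ys X ?Y)"
        using W(2) by (intro spec_multP[OF P2 XP pow_carrier X]) auto
      show ?case unfolding r prod.case
      proof (rule spec_bindP[OF M2, where t = "5 * ?M + \<mu> * w * ?D + ?rest I"], goal_cases)
        case Y1: (1 YP xs3)
        let ?xs3 = "?xs2 @ xs3"
        have E2: "spec (extendP n (basisP d) I\<^sub>1 R\<^sub>1 YP) ?xs3 (\<mu> * w * ?D + 4 * ?M) (extension_of I\<^sub>1 G\<^sub>1 ?Y)"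
          using spec_extendP_basisP[OF holds_append[OF G1(1)] Y1 G1(3) Y W(2)] .
        show ?case
        proof (rule spec_bindP[OF E2, where t = "?M + ?rest I"], goal_cases)
          case E': (1 r' xs4)
          let ?xs4 = "?xs3 @ xs4"
          obtain I\<^sub>2 R\<^sub>2 VP where r' [simp]: "r' = (I\<^sub>2, R\<^sub>2, VP)" by (cases r')
          obtain G\<^sub>2 V where G2: "holds ?xs4 R\<^sub>2 G\<^sub>2" "holds ?xs4 VP V" "red_basis n I\<^sub>2 G\<^sub>2"
            "cs G\<^sub>2 = cs G\<^sub>1 \<boxplus> cs ?Y" "cs G\<^sub>2 = cs G\<^sub>1 \<boxplus> cs V" "V \<in> carrier_mat n (length I\<^sub>2 - length I\<^sub>1)"
            "length I\<^sub>1 \<le> length I\<^sub>2"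
            using E' by (auto simp: extension_of_def)
          have P4: "holds ?xs4 P (A ^\<^sub>m h)" using holds_append2[OF P2] by simp
          have M3: "spec (multP n P P) ?xs4 ?M (\<lambda>X ys. holds ys X (A ^\<^sub>m h * A ^\<^sub>m h))"
            by (intro spec_multP[OF P4 P4 pow_carrier pow_carrier]) auto
          show ?case unfolding r' prod.case
          proof (rule spec_bindP[OF M3, where t = "?rest I"], goal_cases)
            case P': (1 PP xs5)
            let ?w = "length I\<^sub>1 - length I + (length I\<^sub>2 - length I\<^sub>1)"
            have w: "?w = length I\<^sub>2 - length I" using G1(7) G2(7) by simp
            have I2: "length I\<^sub>2 \<le> n" using red_basis_length[OF G2(3)] .
            have UV: "hcat U V \<in> carrier_mat n ?w" using hcat_carrier[OF G1(6) G2(6)] .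
            have k2: "cs G\<^sub>2 = K (k + 2 * h)"
              using kX kY G(2) G1(4) G2(4) by (simp add: mult_2 add.assoc)
            have "K (k + 2 * h) = cs G \<boxplus> cs U \<boxplus> cs V"
              using k2 G2(5) G1(5) by simp
            also have "\<dots> = cs G \<boxplus> cs (hcat U V)"
              using G(2) ssum_assoc[OF kry_carrier[of k] cs_carrier[OF G1(6)] cs_carrier[OF G2(6)]] cs_hcat[OF G1(6) G2(6)]
              by simp
            finally have k3: "K (k + 2 * h) = K (k + 2 * h - 2 * h) \<boxplus> cs (hcat U V)"
              using G(2) by simp
            have P'': "holds (?xs4 @ xs5) PP (A ^\<^sub>m (2 * h))"
              using P' pow_mat_add[OF A, of h h] by (simp add: mult_2)
            have UVP: "holds (?xs4 @ xs5) (hcat UP VP) (hcat U V)"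
              using holds_append[OF G1(2), of "xs3 @ xs4 @ xs5"] holds_append[OF G2(2), of xs5] G1(6) G2(6)
              by (intro holds_hcat) auto
            have IH: "spec (krylovP q I\<^sub>2 R\<^sub>2 (hcat UP VP) PP) (?xs4 @ xs5)
              (q * (11 * ?M) + 2 * \<mu> * ?D * (n - length I\<^sub>2 + ?w))
              (\<lambda>(I', R') ys. \<exists>G'. holds ys R' G' \<and> red_basis n I' G' \<and>
                 cs G' = K (k + 2 * h + 2 * (2 * h) * (2 ^ q - 1)))"
              using holds_append[OF G2(1)] UVP P'' G2(3) k2 UV _ _ k3
              by (rule Suc.IH) (use w I2 in auto)
            have idx: "k + 2 * h + 2 * (2 * h) * (2 ^ q - 1) = k + 2 * h * (2 ^ Suc q - 1)"
            proof -
              obtain p :: nat where "2 ^ q = Suc p" using not0_implies_Suc[of "2 ^ q"] by auto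
              then show ?thesis by (simp add: algebra_simps)
            qed
            \<comment> \<open>The new potential has dropped by exactly \<open>w\<close>, whatever
              the number of new pivots.\<close>
            have "n - length I\<^sub>2 + ?w = n - length I" using w I2 G1(7) G2(7) by simp
            then show ?case using IH unfolding idx by simp
          qed simp
        qed simp
      qed simp
    qed (simp add: algebra_simps)
  next
    case 2
    have "2 * \<mu> * ?D * (n - length I + w) = 2 * \<mu> * ?D * (n - length I) + 2 * \<mu> * ?D * w"
      by (rule distrib_left)
    then show ?case by (simp only: mult_Suc)
  qed
qed

section \<open>The complete computation of the Kalman form\<close>

definition kalmanP :: "nat \<Rightarrow> nat mat \<Rightarrow> nat mat \<Rightarrow> (nat \<times> nat list, 'a) prog" where
  "kalmanP c P Q =
     bindP (colbasisP c Q) (\<lambda>(I\<^sub>0, G\<^sub>0). bindP (krylovP d I\<^sub>0 G\<^sub>0 G\<^sub>0 P) (\<lambda>(I, G).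
     let J = filter (\<lambda>j. j \<notin> set I) [0..<n]; X = sel I (pick J P) in
     bindP (constP 0) (\<lambda>z. bindP (constP 1) (\<lambda>u.
     bindP (multP n (sel I P) G) (\<lambda>H. bindP (multP n (sel J G) X) (\<lambda>Z. bindP (subP (sel J (pick J P)) Z) (\<lambda>Y.
     retP (length I, entries (hcat G (pick J (mat n n (\<lambda>(i, j). if i = j then u else z)))) @
       entries H @ entries X @ entries Y @ entries (sel I Q)))))))))"

lemma over_kalmanP [over]: "over F (kalmanP c P Q)"
  unfolding kalmanP_def Let_def by (intro over F)

text \<open>In the cost, \<open>c\<close> times \<open>4 * d + 6\<close> is for the columns of
  \<open>B\<close>, the further 2 covers the initial potential of \<open>krylovP\<close>,
  \<open>11 * d\<close> its fixed costs, and 3 stands for two products and a subtraction at the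
  end.\<close>

lemma spec_kalmanP:
  assumes P: "holds xs P A" and Q: "holds xs Q B" and A: "A \<in> carrier_mat n n" and B: "B \<in> carrier_mat n m"
    and m: "m \<le> c * n"
  shows "spec (kalmanP c P Q) xs (\<mu> * n * ((c + 2) * (4 * d + 6) + 11 * d + 3))
    (\<lambda>(r, js) ys. \<exists>out. cells ys js out \<and> (\<exists>T H X Y B\<^sub>1. is_kalman_form n m A B r T H X Y B\<^sub>1 \<and>
       out = entries T @ entries H @ entries X @ entries Y @ entries B\<^sub>1))"
proof -
  interpret krylov A B n m using A B by unfold_locales
  let ?M = "\<mu> * n" and ?D = "4 * d + 2"
  have "slice 0 m B = B" using B by (intro eq_matI) (auto simp: slice_def)
  then have "spec (colbasisP c Q) xs (c * (?M * (4 * d + 6)))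
    (\<lambda>(I, R) ys. \<exists>G. holds ys R G \<and> red_basis n I G \<and> cs G = cs B)"
    using spec_colbasisP[OF Q B, of c] m by (simp add: min_absorb1)
  then show ?thesis unfolding kalmanP_def Let_def
  proof (rule spec_bindP[where t = "d * (11 * ?M) + 2 * (?M * ?D) + 3 * ?M"], goal_cases)
    case (1 IG xs1)
    let ?xs1 = "xs @ xs1"
    obtain I\<^sub>0 R\<^sub>0 where r: "IG = (I\<^sub>0, R\<^sub>0)" by (cases IG)
    obtain G\<^sub>0 where G0: "holds ?xs1 R\<^sub>0 G\<^sub>0" "red_basis n I\<^sub>0 G\<^sub>0" "cs G\<^sub>0 = K 1"
      using 1 kry_1 by (auto simp: r)
    have G0c: "G\<^sub>0 \<in> carrier_mat n (length I\<^sub>0)" using G0(2) by (simp add: red_basis_def)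
    have I0: "length I\<^sub>0 \<le> n" using red_basis_length[OF G0(2)] .
    have P1: "holds ?xs1 P (A ^\<^sub>m 1)" using holds_append[OF P] A by simp
    \<comment> \<open>The iteration starts with h = k = 1, where a basis of \<open>K 1\<close>
      complements the zero space. As \<open>W\<close> and \<open>G\<close> are the same matrix, the
      potential starts at n.\<close>
    have "K 1 = K (1 - 1) \<boxplus> cs G\<^sub>0" using G0(3) ssum_zero[OF kry_carrier[of 1]] A by simp
    from spec_krylovP[OF krylov_axioms G0(1) G0(1) P1 G0(2,3) G0c I0 le_refl this, of d]
    have 2: "spec (krylovP d I\<^sub>0 R\<^sub>0 R\<^sub>0 P) ?xs1 (d * (11 * ?M) + 2 * (?M * ?D))
      (\<lambda>(I', R') ys. \<exists>G'. holds ys R' G' \<and> red_basis n I' G' \<and> cs G' = K (1 + 2 * 1 * (2 ^ d - 1)))"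
      by (rule spec_mono) (use I0 in \<open>auto simp: algebra_simps\<close>)
    show ?case unfolding r prod.case
    proof (rule spec_bindP[OF 2, where t = "3 * ?M"], goal_cases)
      case (1 IG xs2)
      let ?xs2 = "?xs1 @ xs2"
      obtain I R where r: "IG = (I, R)" by (cases IG)
      \<comment> \<open>The index reached is \<open>2 ^ (d + 1) - 1\<close>, at least
        \<open>n\<close> by the choice of \<open>d\<close>.\<close>
      have "K (1 + 2 * 1 * (2 ^ d - 1)) = K n" using d by (intro kry_eq) simp
      then obtain G where RG: "holds ?xs2 R G" "red_basis n I G" "cs G = K n"
        using 1 unfolding r prod.case by metis
      let ?J = "filter (\<lambda>j. j \<notin> set I) [0..<n]"
      interpret completion n I ?J G using RG(2) by unfold_locales auto
      have J: "set ?J \<subseteq> {..<n}" by auto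
      have JA: "pick ?J A \<in> carrier_mat n (length ?J)" using A by simp
      have len: "length I \<le> n" "length ?J \<le> n" using lengths by auto
      let ?X = "sel I (pick ?J A)"
      have X: "?X \<in> carrier_mat (length I) (length ?J)" using JA by (rule sel_carrier)
      have Z: "sel ?J G * ?X \<in> carrier_mat (length ?J) (length ?J)"
        using sel_carrier[OF G(1)] X by (rule mult_carrier_mat)
      show ?case unfolding r prod.case
      proof (rule spec_bindP[OF spec_constP, where t = "3 * ?M"], goal_cases)
        case z: (1 z xs3)
        show ?case
        proof (rule spec_bindP[OF spec_constP, where t = "3 * ?M"], goal_cases)
          case u: (1 u xs4)
          let ?xs4 = "(?xs2 @ xs3) @ xs4"
          have R4: "holds ?xs4 R G" using holds_append2[OF RG(1)] by simp
          have P4: "holds ?xs4 P A" using holds_append[OF P, of "xs1 @ xs2 @ xs3 @ xs4"] by simp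
          have Q4: "holds ?xs4 Q B" using holds_append[OF Q, of "xs1 @ xs2 @ xs3 @ xs4"] by simp
          have XP: "holds ?xs4 (sel I (pick ?J P)) ?X"
            using holds_sel[OF holds_pick[OF P4 A J] JA G(3)] .
          have 3: "spec (multP n (sel I P) R) ?xs4 ?M (\<lambda>X ys. holds ys X (sel I A * G))"
            using len G
            by (intro spec_multP[OF holds_sel[OF P4 A] R4 sel_carrier[OF A]]) auto
          show ?case
          proof (rule spec_bindP[OF 3, where t = "2 * ?M"], goal_cases)
            case H: (1 HP xs5)
            let ?xs5 = "?xs4 @ xs5"
            have 4: "spec (multP n (sel ?J R) (sel I (pick ?J P))) ?xs5 ?M
              (\<lambda>X ys. holds ys X (sel ?J G * ?X))"
              using len by (intro spec_multP[OF holds_sel[OF holds_append[OF R4] G(1) J]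
                    holds_append[OF XP] sel_carrier[OF G(1)] X]) auto
            show ?case
            proof (rule spec_bindP[OF 4, where t = ?M], goal_cases)
              case ZP: (1 ZP xs6)
              let ?xs6 = "?xs5 @ xs6"
              have "length ?J * length ?J \<le> ?M" using len \<mu>(2) by (intro mult_le_mono) auto
              then have 5: "spec (subP (sel ?J (pick ?J P)) ZP) ?xs6 ?M
                (\<lambda>X ys. holds ys X (sel ?J (pick ?J A) - sel ?J G * ?X))"
                by (intro spec_subP[OF _ ZP sel_carrier[OF JA] Z] holds_sel[OF _ JA J] holds_pick[OF _ A J])
                   (use holds_append2[OF P4] in auto)
              show ?case
              proof (rule spec_bindP[OF 5, where t = 0], goal_cases)
                case Y: (1 YP xs7)
                let ?xs7 = "?xs6 @ xs7"
                have "holds ?xs7 (mat n n (\<lambda>(i, j). if i = j then u else z)) (1\<^sub>m n)"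
                  using cell_append[OF z, of "xs4 @ xs5 @ xs6 @ xs7"] cell_append[OF u, of "xs5 @ xs6 @ xs7"]
                  by (auto simp: holds_def)
                then have TP: "holds ?xs7 (hcat R (pick ?J (mat n n (\<lambda>(i, j). if i = j then u else z))))
                  (hcat G (pick ?J (1\<^sub>m n)))"
                  using holds_append[OF R4, of "xs5 @ xs6 @ xs7"] J G(1)
                  by (intro holds_hcat holds_pick[OF _ one_carrier_mat]) (auto simp: pick_def)
                have "holds ?xs7 HP (sel I A * G)" using holds_append2[OF H] by simp
                moreover have "holds ?xs7 (sel I (pick ?J P)) ?X"
                  using holds_append[OF XP, of "xs5 @ xs6 @ xs7"] by simp
                moreover have "holds ?xs7 (sel I Q) (sel I B)"
                  using holds_append[OF Q4, of "xs5 @ xs6 @ xs7"] B G(3)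
                  by (intro holds_sel) auto
                ultimately show ?case
                  using kalman_form[OF krylov_axioms completion_axioms RG(3)] TP Y
                  by (intro spec_retP, unfold prod.case)
                     (blast intro: cells_appendI holds_entries)
              qed simp
            qed simp
          qed simp
        qed simp
      qed simp
    qed simp
  qed (simp add: algebra_simps)
qed

end


section \<open>The complexity bound\<close>

text \<open>The inequality \<open>n * n \<le> 2 * f n\<close> holds for every n, so it compares
  growth rates. Its purpose is \<open>block_cost\<close>, where the exponent \<omega> - 2 must not
  be negative.\<close>

lemma matmul_exponent_ge_2:
  assumes "(\<lambda>n. real (f n)) \<in> O(\<lambda>n. real n powr \<omega>)" "\<And>n. matmul_within (K :: 'a::field set) n (f n)"
  shows "2 \<le> \<omega>"
proof -
  have "real n powr 2 \<le> 2 * real (f n)" for n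
  proof -
    have "real (n * n) \<le> real (2 * f n)"
      using matmul_lower_bound[OF assms(2)] by (simp only: of_nat_le_iff)
    then show ?thesis by (cases "n = 0") (simp_all add: power2_eq_square)
  qed
  then have "(\<lambda>n. real n powr 2) \<in> O(\<lambda>n. real (f n))"
    by (intro bigoI[of _ 2] always_eventually) simp
  then have "(\<lambda>n. real n powr 2) \<in> O(\<lambda>n. real n powr \<omega>)"
    using assms(1) by (rule landau_o.big_trans)
  then show ?thesis
    using powr_bigo_iff[OF filterlim_real_sequentially, of 2 \<omega>] by simp
qed

text \<open>Landau bounds say nothing about small arguments, but blocks of every size from 1 on
  occur. The finitely many exceptions are absorbed by adding their sum to the constant.\<close>

lemma powr_bound_everywhere:
  assumes "(\<lambda>n. real (f n)) \<in> O(\<lambda>n. real n powr \<omega>)" "\<omega> \<ge> 0"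
  obtains C where "C > 0" "\<And>n. n \<ge> 1 \<Longrightarrow> real (f n) \<le> C * real n powr \<omega>"
proof -
  obtain c where c: "c > 0" "eventually (\<lambda>n. norm (real (f n)) \<le> c * norm (real n powr \<omega>)) sequentially"
    using assms(1) by (rule landau_o.bigE)
  then obtain N where N: "\<And>n. n \<ge> N \<Longrightarrow> real (f n) \<le> c * real n powr \<omega>"
    by (auto simp: eventually_sequentially)
  have "real (f n) \<le> (c + (\<Sum>i<N. real (f i))) * real n powr \<omega>" if "n \<ge> 1" for n
  proof -
    have S: "0 \<le> (\<Sum>i<N. real (f i))" by (intro sum_nonneg) simp
    have p: "1 \<le> real n powr \<omega>" using that assms(2) by (intro ge_one_powr_ge_zero) auto
    have "real (f n) \<le> c * real n powr \<omega> + (\<Sum>i<N. real (f i)) * real n powr \<omega>"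
    proof (cases "n < N")
      case True
      then have "real (f n) \<le> (\<Sum>i<N. real (f i))" by (intro member_le_sum) auto
      also have "\<dots> \<le> (\<Sum>i<N. real (f i)) * real n powr \<omega>" using S p by (simp add: mult_le_cancel_left1)
      finally show ?thesis using c(1) by (simp add: add_increasing)
    next
      case False
      then show ?thesis using N[of n] S by (simp add: add_increasing2)
    qed
    then show ?thesis by (simp add: distrib_right)
  qed
  moreover have "0 < c + (\<Sum>i<N. real (f i))" using c(1) by (intro add_pos_nonneg sum_nonneg) auto
  ultimately show ?thesis using that by blast
qed

text \<open>Rounding up to full strips at most doubles the number of rows, hence the 2. Splitting
  off two factors \<open>e\<close> from \<open>e powr \<omega>\<close> leaves the exponent \<omega>
  - 2, and this rest can only grow when \<open>e\<close> is replaced by \<open>n\<close>.\<close>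

lemma block_cost:
  assumes "2 \<le> \<omega>" "1 \<le> e" "e \<le> n" "C > 0" "real k \<le> C * real e powr \<omega>"
  shows "real ((n + e - 1) div e * k) \<le> 2 * C * real n powr (\<omega> - 1) * real e"
proof -
  have "(n + e - 1) div e * e \<le> 2 * n" using assms(3) div_times_less_eq_dividend[of "n + e - 1" e] by linarith
  then have q: "real ((n + e - 1) div e) * real e \<le> 2 * real n" by (simp flip: of_nat_mult)
  have "real e powr \<omega> = real e * (real e * real e powr (\<omega> - 2))"
    using assms(2) powr_add[of "real e" 2 "\<omega> - 2"] by (simp add: power2_eq_square)
  moreover have "real e powr (\<omega> - 2) \<le> real n powr (\<omega> - 2)"
    using assms by (intro powr_mono2) auto
  ultimately have "real k \<le> C * (real e * (real e * real n powr (\<omega> - 2)))"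
    using assms(4,5) by (simp add: order_trans[OF assms(5)] mult_left_mono)
  then have "real ((n + e - 1) div e * k) \<le> real ((n + e - 1) div e) * (C * (real e * (real e * real n powr (\<omega> - 2))))"
    by (simp add: mult_left_mono)
  also have "\<dots> = (real ((n + e - 1) div e) * real e) * (C * real e * real n powr (\<omega> - 2))"
    by (simp add: mult_ac)
  also have "\<dots> \<le> (2 * real n) * (C * real e * real n powr (\<omega> - 2))"
    using q assms(4) by (intro mult_right_mono) auto
  also have "\<dots> = 2 * C * (real n * real n powr (\<omega> - 2)) * real e" by (simp add: mult_ac)
  also have "real n * real n powr (\<omega> - 2) = real n powr (\<omega> - 1)"
    using assms(2,3) powr_add[of "real n" 1 "\<omega> - 2"] by simp
  finally show ?thesis .
qed

theorem corollary4p1: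
  fixes K :: "'a::field set" and \<omega> :: real and c :: nat
  assumes "subfield K class_ring"
    and "matmul_exponent K \<omega>"
  shows "\<exists>f :: nat \<Rightarrow> nat.
    (\<lambda>n. real (f n)) \<in> O(\<lambda>n. real n powr \<omega> * ln (real n)) \<and>
    (\<forall>n m. m \<le> c * n \<longrightarrow> kalman_within K n m (f n))"
proof -
  obtain g where g: "(\<lambda>n. real (g n)) \<in> O(\<lambda>n. real n powr \<omega>)" "\<And>n. matmul_within K n (g n)"
    using assms(2) unfolding matmul_exponent_def by blast
  have \<omega>: "2 \<le> \<omega>" using g by (rule matmul_exponent_ge_2)
  obtain C where C: "C > 0" "\<And>n. n \<ge> 1 \<Longrightarrow> real (g n) \<le> C * real n powr \<omega>"
    using powr_bound_everywhere[OF g(1)] \<omega> by auto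
  \<comment> \<open>The summand \<open>n\<close> gives n \<le> \<mu>, the other one is the bound of
    \<open>block_cost\<close> per column.\<close>
  define \<mu> where "\<mu> n = n + nat \<lceil>2 * C * real n powr (\<omega> - 1)\<rceil>" for n
  define d where "d n = nat \<lceil>log 2 (real n)\<rceil>" for n
  define f where "f n = \<mu> n * n * ((c + 2) * (4 * d n + 6) + 11 * d n + 3)" for n
  obtain MM :: "nat \<Rightarrow> (unit, 'a) ctree" where MM: "\<And>e. scalars (MM e) \<subseteq> K"
    "\<And>e A B. A \<in> carrier_mat e e \<Longrightarrow> B \<in> carrier_mat e e \<Longrightarrow>
       \<exists>k \<le> g e. run (MM e) (entries A @ entries B) = Some ((), entries (A * B), k)"
    using g(2) unfolding matmul_within_def by metis
  \<comment> \<open>Apart from the constants of the multiplication trees, the programs use only 0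
    and 1, which every subfield contains.\<close>
  have K: "0 \<in> K" "1 \<in> K"
    using subringE(2,3)[OF subfieldE(1)[OF assms(1)]] by (simp_all add: class_ring_simps)
  have alg: "kalman_alg K MM g n (\<mu> n) (d n)" for n
  proof
    show "(n + e - 1) div e * g e \<le> \<mu> n * e" if e: "1 \<le> e" "e \<le> n" for e
    proof -
      have "real ((n + e - 1) div e * g e) \<le> 2 * C * real n powr (\<omega> - 1) * real e"
        using block_cost[OF \<omega> e C(1) C(2)[OF e(1)]] .
      also have "\<dots> \<le> real (\<mu> n) * real e"
        unfolding \<mu>_def by (intro mult_right_mono) linarith+
      finally show ?thesis by (simp flip: of_nat_mult)
    qed
    show "n \<le> 2 ^ d n"
    proof (cases "n = 0")
      case False
      then have "real n = 2 powr log 2 (real n)" by simp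
      also have "\<dots> \<le> 2 powr real (d n)" unfolding d_def by (intro powr_mono) linarith+
      also have "\<dots> = real (2 ^ d n)" by (simp add: powr_realpow)
      finally show ?thesis by (simp only: of_nat_le_iff)
    qed simp
    show "n \<le> \<mu> n" unfolding \<mu>_def by (rule le_add1)
  qed (fact MM K)+
  have "kalman_within K n m (f n)" if m: "m \<le> c * n" for n m
  proof -
    interpret kalman_alg K MM g n "\<mu> n" "d n" by (rule alg)
    \<comment> \<open>These are the addresses of the entries in the initial memory, where
      \<open>A\<close> is followed by \<open>B\<close>, both row by row.\<close>
    let ?P = "mat n n (\<lambda>(i, j). i * n + j)" and ?Q = "mat n m (\<lambda>(i, j). n * n + (i * m + j))"
    let ?N = "n * n + n * m"
    let ?t = "graft (kalmanP c ?P ?Q ?N) ?N (\<lambda>(r, js) N. Leaf r js)"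
    show ?thesis unfolding kalman_within_def
    proof (intro exI[of _ ?t] conjI ballI)
      show "scalars ?t \<subseteq> K"
        using over_kalmanP[of c ?P ?Q] by (intro scalars_graft) (auto simp: over_def split: prod.splits)
      fix A B :: "'a mat" assume A: "A \<in> carrier_mat n n" and B: "B \<in> carrier_mat n m"
      let ?xs = "entries A @ entries B"
      have len: "length (entries A) = n * n" "length ?xs = ?N" using A B by simp_all
      have P: "holds ?xs ?P A"
      proof -
        have "?xs ! (i * n + j) = A $$ (i, j) \<and> i * n + j < length ?xs" if "i < n" "j < n" for i j
          using that A index_less[OF that] nth_entries[of i A j] by (simp add: nth_append)
        then show ?thesis using A by (auto simp: holds_def cell_def)
      qed
      have Q: "holds ?xs ?Q B"
      proof -
        have "?xs ! (n * n + (i * m + j)) = B $$ (i, j) \<and> n * n + (i * m + j) < length ?xs" if "i < n" "j < m" for i j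
          using that A B index_less[OF that] nth_entries[of i B j] by (simp add: nth_append)
        then show ?thesis using B by (auto simp: holds_def cell_def)
      qed
      from spec_run[OF spec_kalmanP[OF P Q A B m]] obtain r T H X Y B\<^sub>1 k where
        "k \<le> f n" "is_kalman_form n m A B r T H X Y B\<^sub>1"
        "run ?t ?xs = Some (r, entries T @ entries H @ entries X @ entries Y @ entries B\<^sub>1, k)"
        unfolding len(2) f_def by blast
      then show "\<exists>r T H X Y B\<^sub>1. is_kalman_form n m A B r T H X Y B\<^sub>1 \<and>
        (\<exists>k\<le>f n. run ?t ?xs = Some (r, entries T @ entries H @ entries X @ entries Y @ entries B\<^sub>1, k))"
        by blast
    qed
  qed
  moreover have "(\<lambda>n. real (f n)) \<in> O(\<lambda>n. real n powr \<omega> * ln (real n))"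
  \<comment> \<open>The bound is shown from n = 2 on, since ln 1 = 0. There \<open>d n\<close> is at
    least 1, which absorbs the additive constants with 34 = 2 * 10 + 14, and at most twice the
    binary logarithm, which gives \<open>2 / ln 2\<close>. The factor \<open>2 + 2 * C\<close>
    collects the three summands bounding \<open>\<mu> n\<close>.\<close>
  proof (rule bigoI[of _ "(2 + 2 * C) * (real (10 * c + 34) * (2 / ln 2))"], rule eventually_mono[OF eventually_ge_at_top[of 2]])
    fix n :: nat assume n: "2 \<le> n"
    have "real n powr 1 \<le> real n powr (\<omega> - 1)" using n \<omega> by (intro powr_mono) auto
    moreover have "1 \<le> real n powr (\<omega> - 1)" using n \<omega> by (intro ge_one_powr_ge_zero) auto
    moreover have "real (\<mu> n) \<le> real n + (2 * C * real n powr (\<omega> - 1) + 1)"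
      using C(1) unfolding \<mu>_def by (simp add: of_nat_nat)
    ultimately have "real (\<mu> n) \<le> (2 + 2 * C) * real n powr (\<omega> - 1)"
      using n by (simp add: distrib_right)
    then have "real (\<mu> n) * real n \<le> (2 + 2 * C) * real n powr (\<omega> - 1) * real n"
      by (intro mult_right_mono) auto
    also have "\<dots> = (2 + 2 * C) * real n powr \<omega>"
      using n powr_add[of "real n" "\<omega> - 1" 1] by simp
    finally have \<mu>_le: "real (\<mu> n) * real n \<le> (2 + 2 * C) * real n powr \<omega>" .
    have log: "1 \<le> log 2 (real n)" using n by (subst le_log_iff) auto
    then have "real (d n) \<le> 2 * log 2 (real n)" unfolding d_def by linarith
    then have d_le: "real (d n) \<le> 2 / ln 2 * ln (real n)" by (simp add: log_def)
    have "1 \<le> d n" using log unfolding d_def by linarith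
    then have "4 * d n + 6 \<le> 10 * d n" "11 * d n + 3 \<le> 14 * d n" by simp_all
    moreover from this(1) have "(c + 2) * (4 * d n + 6) \<le> (c + 2) * (10 * d n)"
      by (rule mult_le_mono2)
    ultimately have "(c + 2) * (4 * d n + 6) + 11 * d n + 3 \<le> (10 * c + 34) * d n"
      by (simp add: algebra_simps)
    then have "real ((c + 2) * (4 * d n + 6) + 11 * d n + 3) \<le> real ((10 * c + 34) * d n)"
      by (simp only: of_nat_le_iff)
    also have "\<dots> = real (10 * c + 34) * real (d n)" by (rule of_nat_mult)
    also have "\<dots> \<le> real (10 * c + 34) * (2 / ln 2 * ln (real n))"
      using d_le by (rule mult_left_mono) simp
    finally have "real ((c + 2) * (4 * d n + 6) + 11 * d n + 3) \<le> \<dots>" .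
    with \<mu>_le have "real (\<mu> n) * real n * real ((c + 2) * (4 * d n + 6) + 11 * d n + 3)
      \<le> (2 + 2 * C) * real n powr \<omega> * (real (10 * c + 34) * (2 / ln 2 * ln (real n)))"
      by (rule mult_mono) (use C(1) in simp_all)
    then show "norm (real (f n)) \<le> (2 + 2 * C) * (real (10 * c + 34) * (2 / ln 2)) * norm (real n powr \<omega> * ln (real n))"
      using n by (simp add: f_def abs_mult mult_ac del: of_nat_add)
  qed
  ultimately show ?thesis by blast
qed

end
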